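(* (i) For each $\gamma\in[0,\infty[$ the Fréchet space $A^{-\gamma}_+$ is isomorphic (as a topological vector space) to the Köthe echelon space $\lambda_\infty(A_\gamma)$, where $A_\gamma=(a_k)_{k\in\mathbb{N}}$, $a_k(j)=s_{\mu_k}(j)$ for $j=0,1,2,\ldots$, and $\mu_k=\gamma+\frac1k$. (ii) For each $\gamma\in\,]0,\infty[$ the (LB)-space $A^{-\gamma}_-$ is isomorphic (as a topological vector space) to the Köthe co-echelon space $k_\infty(V_\gamma)$, where $V_\gamma=(v_k)_k$, $v_k(j)=s_{\nu_k}(j)$ for $j=0,1,2,\ldots$, and $\nu_k=\gamma-\frac1k$, with $k\in\mathbb{N}$ large enough that $\nu_k>0$.
   Context: Let $\mathbb{N}=\{1,2,\ldots\}$ and $\mathbb{D}=\{z\in\mathbb{C}:|z|<1\}$. For $f:\mathbb{D}\to\mathbb{C}$ and $0\le r<1$ put $M_\infty(f,r)=\sup_{|z|=r}|f(z)|$. For $\mu>0$ let $\|f\|_\mu=\sup_{0\le r<1}M_\infty(f,r)(1-r)^\mu$, and let $A^{-\mu}$ be the Banach space of all analytic $f:\mathbb{D}\to\mathbb{C}$ with $\|f\|_\mu<\infty$, normed by $\|\cdot\|_\mu$. For $\gamma\in[0,\infty[$, $A^{-\gamma}_+=\bigcap_{\mu>\gamma}A^{-\mu}$ with the Fréchet topology generated by the norms $\|\cdot\|_\mu$, $\mu>\gamma$. For $\gamma\in\,]0,\infty[$, $A^{-\gamma}_-=\bigcup_{0<\mu<\gamma}A^{-\mu}$ with the finest locally convex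 topology such that all inclusions $A^{-\mu}\subset A^{-\gamma}_-$, $0<\mu<\gamma$, are continuous. For $\mu\in\,]0,\infty[$ define $s_\mu(0)=1$ and $s_\mu(j)=\left(\frac{\mu}{j+\mu}\right)^{\mu}$ for $j=1,2,\ldots$. If $0<\mu_2<\mu_1$ then $s_{\mu_1}(j)\le s_{\mu_2}(j)$ for all $j$, so the sequence $(a_k)_k$ is increasing in $k$ and the sequence $(v_k)_k$ is decreasing in $k$. For a strictly positive function $w$ on $\mathbb{N}\cup\{0\}$, $\ell_\infty(w)$ is the Banach space of complex sequences $x=(x_j)_{j\ge0}$ with $\sup_j w(j)|x_j|<\infty$, normed by this supremum. For a Köthe matrix $A=(a_k)_{k\in\mathbb{N}}$, i.e. functions $a_k:\mathbb{N}\cup\{0\}\to\,]0,\infty[$ with $a_k(j)\le a_{k+1}(j)$ for all $j,k$, the Köthe echelon space of order infinity is $\lambda_\infty(A)=\bigcap_{k}\ell_\infty(a_k)$, a Fréchet space with the seminorms $x\mapsto\sup_j a_k(j)|x_j|$, $k\in\mathbb{N}$. For a decreasing sequence $V=(v_k)_k$ of strictly positive functions on $\mathbb{N}\cup\{0\}$, the Köthe co-echelon space of order infinity is $k_\infty(V)=\bigcup_k\ell_\infty(v_k)$ endowed with the locally convex inductive limit topology of the Banach spaces $\ell_\infty(v_k)$. *)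

theory Defs
  imports "HOL-Analysis.Analysis"
begin

section \<open>Topologies on spaces of complex-valued functions\<close>

text \<open>
  All spaces are linear subspaces of \<open>'a \<Rightarrow> complex\<close> with the pointwise operations: \<open>'a = complex\<close>
  for functions on the disc (extended by \<open>0\<close>), \<open>'a = nat\<close> for sequences.
\<close>

definition fun_subspace :: "('a \<Rightarrow> complex) set \<Rightarrow> bool" where
  "fun_subspace E \<longleftrightarrow> (\<lambda>_. 0) \<in> E \<and> (\<forall>f\<in>E. \<forall>g\<in>E. (\<lambda>z. f z + g z) \<in> E) \<and>
     (\<forall>c. \<forall>f\<in>E. (\<lambda>z. c * f z) \<in> E)"

definition fun_convex :: "('a \<Rightarrow> complex) set \<Rightarrow> bool" where
  "fun_convex C \<longleftrightarrow>
     (\<forall>f\<in>C. \<forall>g\<in>C. \<forall>t\<in>{0..1::real}. (\<lambda>z. of_real (1 - t) * f z + of_real t * g z) \<in> C)"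

definition seminorm_topology ::
    "('a \<Rightarrow> complex) set \<Rightarrow> 'i set \<Rightarrow> ('i \<Rightarrow> ('a \<Rightarrow> complex) \<Rightarrow> real) \<Rightarrow> ('a \<Rightarrow> complex) topology" where
  "seminorm_topology E I p =
     topology_generated_by {{g\<in>E. p i (\<lambda>z. g z - f z) < e} | i f e. i \<in> I \<and> f \<in> E \<and> e > 0}"

definition locally_convex_topology_on ::
    "('a \<Rightarrow> complex) set \<Rightarrow> ('a \<Rightarrow> complex) topology \<Rightarrow> bool" where
  "locally_convex_topology_on E X \<longleftrightarrow>
     topspace X = E \<and>
     continuous_map (prod_topology X X) X (\<lambda>(f, g). \<lambda>z. f z + g z) \<and>
     continuous_map (prod_topology euclidean X) X (\<lambda>(c, f). \<lambda>z. c * f z) \<and>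
     neighbourhood_base_at (\<lambda>_. 0) fun_convex X"

text \<open>
  The finest locally convex topology on the union of the spaces \<open>topspace (X i)\<close>, \<open>i \<in> I\<close>, that makes
  all inclusions continuous: the supremum of all locally convex topologies that do so. That this
  supremum is itself one of them is lemma \<open>lc_inductive_topology_finest\<close>.
\<close>

definition lc_inductive_topology ::
    "'i set \<Rightarrow> ('i \<Rightarrow> ('a \<Rightarrow> complex) topology) \<Rightarrow> ('a \<Rightarrow> complex) topology" where
  "lc_inductive_topology I X =
     topology_generated_by
       (\<Union>{{U. openin Y U} | Y. locally_convex_topology_on (\<Union>i\<in>I. topspace (X i)) Y \<and>
                              (\<forall>i\<in>I. continuous_map (X i) Y (\<lambda>f. f))})"

definition tvs_isomorphic ::
    "('a \<Rightarrow> complex) topology \<Rightarrow> ('b \<Rightarrow> complex) topology \<Rightarrow> bool" where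
  "tvs_isomorphic X Y \<longleftrightarrow>
     (\<exists>T. homeomorphic_map X Y T \<and>
          (\<forall>f\<in>topspace X. \<forall>g\<in>topspace X. T (\<lambda>z. f z + g z) = (\<lambda>j. T f j + T g j)) \<and>
          (\<forall>c. \<forall>f\<in>topspace X. T (\<lambda>z. c * f z) = (\<lambda>j. c * T f j)))"


section \<open>Growth spaces of analytic functions on the unit disc\<close>

definition M_infty :: "(complex \<Rightarrow> complex) \<Rightarrow> real \<Rightarrow> real" where
  "M_infty f r = (SUP z\<in>sphere 0 r. norm (f z))"

definition growth_norm :: "real \<Rightarrow> (complex \<Rightarrow> complex) \<Rightarrow> real" where
  "growth_norm \<mu> f = (SUP r\<in>{0..<1}. M_infty f r * (1 - r) powr \<mu>)"

text \<open>
  The value \<open>0\<close> outside the disc makes functions on the disc correspond bijectively and linearly to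
  total ones. For analytic \<open>f\<close> the suprema in \<^const>\<open>M_infty\<close> are finite by compactness, so
  \<^const>\<open>bdd_above\<close> expresses that the norm is finite.
\<close>

definition A_minus :: "real \<Rightarrow> (complex \<Rightarrow> complex) set" where
  "A_minus \<mu> = {f. f analytic_on ball 0 1 \<and> (\<forall>z. z \<notin> ball 0 1 \<longrightarrow> f z = 0) \<and>
                   bdd_above ((\<lambda>r. M_infty f r * (1 - r) powr \<mu>) ` {0..<1})}"

definition A_minus_topology :: "real \<Rightarrow> (complex \<Rightarrow> complex) topology" where
  "A_minus_topology \<mu> = seminorm_topology (A_minus \<mu>) {\<mu>} growth_norm"

definition A_plus :: "real \<Rightarrow> (complex \<Rightarrow> complex) set" where
  "A_plus \<gamma> = (\<Inter>\<mu>\<in>{\<gamma><..}. A_minus \<mu>)"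

definition A_plus_topology :: "real \<Rightarrow> (complex \<Rightarrow> complex) topology" where
  "A_plus_topology \<gamma> = seminorm_topology (A_plus \<gamma>) {\<gamma><..} growth_norm"

definition A_union :: "real \<Rightarrow> (complex \<Rightarrow> complex) set" where
  "A_union \<gamma> = (\<Union>\<mu>\<in>{0<..<\<gamma>}. A_minus \<mu>)"

definition A_union_topology :: "real \<Rightarrow> (complex \<Rightarrow> complex) topology" where
  "A_union_topology \<gamma> = lc_inductive_topology {0<..<\<gamma>} A_minus_topology"


section \<open>Echelon and co-echelon spaces of order infinity\<close>

definition linf_norm :: "(nat \<Rightarrow> real) \<Rightarrow> (nat \<Rightarrow> complex) \<Rightarrow> real" where
  "linf_norm w x = (SUP j. w j * norm (x j))"

definition linf :: "(nat \<Rightarrow> real) \<Rightarrow> (nat \<Rightarrow> complex) set" where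
  "linf w = {x. bdd_above (range (\<lambda>j. w j * norm (x j)))}"

definition linf_topology :: "(nat \<Rightarrow> real) \<Rightarrow> (nat \<Rightarrow> complex) topology" where
  "linf_topology w = seminorm_topology (linf w) {w} linf_norm"

text \<open>
  The index set \<open>K\<close> of the sequence of weights is explicit, as the weights \<open>v\<^sub>k\<close> of the co-echelon
  space below are only defined for large \<open>k\<close>.
\<close>

definition kothe_echelon :: "nat set \<Rightarrow> (nat \<Rightarrow> nat \<Rightarrow> real) \<Rightarrow> (nat \<Rightarrow> complex) set" where
  "kothe_echelon K a = (\<Inter>k\<in>K. linf (a k))"

definition kothe_echelon_topology :: "nat set \<Rightarrow> (nat \<Rightarrow> nat \<Rightarrow> real) \<Rightarrow> (nat \<Rightarrow> complex) topology" where
  "kothe_echelon_topology K a =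
     seminorm_topology (kothe_echelon K a) K (\<lambda>k. linf_norm (a k))"

definition kothe_coechelon :: "nat set \<Rightarrow> (nat \<Rightarrow> nat \<Rightarrow> real) \<Rightarrow> (nat \<Rightarrow> complex) set" where
  "kothe_coechelon K v = (\<Union>k\<in>K. linf (v k))"

definition kothe_coechelon_topology :: "nat set \<Rightarrow> (nat \<Rightarrow> nat \<Rightarrow> real) \<Rightarrow> (nat \<Rightarrow> complex) topology" where
  "kothe_coechelon_topology K v = lc_inductive_topology K (\<lambda>k. linf_topology (v k))"

definition s_weight :: "real \<Rightarrow> nat \<Rightarrow> real" where
  "s_weight \<mu> j = (if j = 0 then 1 else (\<mu> / (real j + \<mu>)) powr \<mu>)"


section \<open>The topologies are what they are meant to be\<close>

lemma topspace_seminorm_topology: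
  assumes "I \<noteq> {}" and "\<And>i. i \<in> I \<Longrightarrow> p i (\<lambda>_. 0) = 0"
  shows "topspace (seminorm_topology E I p) = E"
proof -
  obtain i where i: "i \<in> I" using assms by blast
  have "f \<in> \<Union>{{g\<in>E. p i (\<lambda>z. g z - f z) < e} | i f e. i \<in> I \<and> f \<in> E \<and> e > 0}" if "f \<in> E" for f
  proof
    show "f \<in> {g\<in>E. p i (\<lambda>z. g z - f z) < 1}" using that i assms(2) by simp
    show "{g\<in>E. p i (\<lambda>z. g z - f z) < 1}
      \<in> {{g\<in>E. p i (\<lambda>z. g z - f z) < e} | i f e. i \<in> I \<and> f \<in> E \<and> e > 0}"
      using that i zero_less_one by blast
  qed
  then show ?thesis
    unfolding seminorm_topology_def topology_generated_by_topspace by blast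
qed

lemma growth_norm_zero: "growth_norm \<mu> (\<lambda>_. 0) = 0"
  by (simp add: growth_norm_def M_infty_def image_constant_conv)

lemma linf_norm_zero: "linf_norm w (\<lambda>_. 0) = 0"
  by (simp add: linf_norm_def)

lemma locally_convex_indiscrete:
  assumes "fun_subspace E"
  shows "\<exists>Y. locally_convex_topology_on E Y \<and> (\<forall>X. topspace X \<subseteq> E \<longrightarrow> continuous_map X Y (\<lambda>f. f))"
proof (intro exI conjI allI impI)
  let ?Y = "topology_generated_by {E}"
  have o: "U = {} \<or> U = E" if "generate_topology_on {E} U" for U
    using that by (induction rule: generate_topology_on.induct) auto
  have c: "continuous_map X ?Y h" if "h \<in> topspace X \<rightarrow> E" for X :: "'c topology" and h
  proof (rule continuous_on_generated_topo)
    fix U assume "U \<in> {E}"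
    then have "h -` U \<inter> topspace X = topspace X" using that by auto
    then show "openin X (h -` U \<inter> topspace X)" by simp
  qed (use that in auto)
  show "locally_convex_topology_on E ?Y"
    unfolding locally_convex_topology_on_def
  proof (intro conjI)
    have "fun_convex E" unfolding fun_convex_def
    proof (intro ballI)
      fix f g and t :: real assume "f \<in> E" "g \<in> E"
      then have "(\<lambda>z. of_real (1 - t) * f z) \<in> E" "(\<lambda>z. of_real t * g z) \<in> E"
        using assms unfolding fun_subspace_def by blast+
      moreover have "\<And>u v. u \<in> E \<Longrightarrow> v \<in> E \<Longrightarrow> (\<lambda>z. u z + v z) \<in> E"
        using assms unfolding fun_subspace_def by blast
      ultimately show "(\<lambda>z. of_real (1 - t) * f z + of_real t * g z) \<in> E"
        by simp
    qed
    then show "neighbourhood_base_at (\<lambda>_. 0) fun_convex ?Y"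
      unfolding neighbourhood_base_at_def openin_topology_generated_by_iff
      by (metis o empty_iff order_refl)
  qed (use assms in \<open>auto intro!: c simp: fun_subspace_def\<close>)
  show "continuous_map X ?Y (\<lambda>f. f)" if "topspace X \<subseteq> E" for X
    using that by (intro c) auto
qed

lemma lc_inductive_topology_finest:
  fixes X :: "'i \<Rightarrow> ('a \<Rightarrow> complex) topology"
    and I :: "'i set"
  defines "E \<equiv> (\<Union>i\<in>I. topspace (X i))"
  assumes E: "fun_subspace E"
  shows "locally_convex_topology_on E (lc_inductive_topology I X)"
    and "\<And>i. i \<in> I \<Longrightarrow> continuous_map (X i) (lc_inductive_topology I X) (\<lambda>f. f)"
    and "\<And>Y U. \<lbrakk>locally_convex_topology_on E Y; \<And>i. i \<in> I \<Longrightarrow> continuous_map (X i) Y (\<lambda>f. f); openin Y U\<rbrakk>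
           \<Longrightarrow> openin (lc_inductive_topology I X) U"
proof -
  define \<Y> where "\<Y> = {Y. locally_convex_topology_on E Y \<and> (\<forall>i\<in>I. continuous_map (X i) Y (\<lambda>f. f))}"
  define S where "S = (\<Union>Y\<in>\<Y>. {U. openin Y U})"
  let ?L = "lc_inductive_topology I X"
  have L: "?L = topology_generated_by S"
    unfolding lc_inductive_topology_def S_def \<Y>_def E_def
    by (rule arg_cong[where f = topology_generated_by]) blast
  have ts: "topspace Y = E" if "Y \<in> \<Y>" for Y
    using that unfolding \<Y>_def locally_convex_topology_on_def by blast
  have finer: "openin ?L U" if "Y \<in> \<Y>" "openin Y U" for Y U
    unfolding L using that by (auto simp: S_def intro: topology_generated_by_Basis)
  have "\<exists>Y. Y \<in> \<Y>"
    using locally_convex_indiscrete[OF E] unfolding \<Y>_def E_def by blast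
  then obtain Y0 where Y0: "Y0 \<in> \<Y>" by blast
  have "\<Union>S \<subseteq> E" using ts openin_subset unfolding S_def by blast
  moreover have "E \<in> S" using Y0 ts unfolding S_def by (metis UN_I mem_Collect_eq openin_topspace)
  ultimately have top: "topspace ?L = E" unfolding L by auto
  have idc: "continuous_map ?L Y (\<lambda>f. f)" if "Y \<in> \<Y>" for Y
    unfolding continuous_map using that finer ts top
    by (auto simp: openin_subset Collect_conj_eq dest: openin_subset)
  have gen: "continuous_map Z ?L h"
    if "\<And>Y. Y \<in> \<Y> \<Longrightarrow> continuous_map Z Y h" for Z :: "'c topology" and h
    unfolding L
  proof (rule continuous_on_generated_topo)
    fix U assume "U \<in> S"
    then obtain Y where "Y \<in> \<Y>" "openin Y U" unfolding S_def by blast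
    then show "openin Z (h -` U \<inter> topspace Z)"
      using that[of Y] openin_continuous_map_preimage[of Z Y h U]
      by (simp add: vimage_def Int_def conj_commute)
  next
    show "h ` topspace Z \<subseteq> \<Union>S"
      using that[OF Y0] ts[OF Y0] \<open>E \<in> S\<close> continuous_map_image_subset_topspace by blast
  qed
  show "continuous_map (X i) ?L (\<lambda>f. f)" if "i \<in> I" for i
    using that by (intro gen) (auto simp: \<Y>_def)
  show "openin ?L U"
    if "locally_convex_topology_on E Y" "\<And>i. i \<in> I \<Longrightarrow> continuous_map (X i) Y (\<lambda>f. f)" "openin Y U"
    for Y U
    using that by (intro finer[of Y]) (auto simp: \<Y>_def)
  show "locally_convex_topology_on E ?L"
    unfolding locally_convex_topology_on_def
  proof (intro conjI top gen)
    fix Y assume Y: "Y \<in> \<Y>"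
    then have lc: "locally_convex_topology_on E Y" unfolding \<Y>_def by blast
    have "continuous_map (prod_topology ?L ?L) (prod_topology Y Y) (\<lambda>(f, g). (f, g))"
      using idc[OF Y] by (subst continuous_map_prod_top) auto
    then show "continuous_map (prod_topology ?L ?L) Y (\<lambda>(f, g). \<lambda>z. f z + g z)"
      using lc continuous_map_compose unfolding locally_convex_topology_on_def 
      by (fastforce simp: case_prod_unfold comp_def)
    have "continuous_map (prod_topology euclidean ?L) (prod_topology euclidean Y) (\<lambda>(f :: complex, g). (f, g))"
      using idc[OF Y] by (subst continuous_map_prod_top) auto
    then show "continuous_map (prod_topology euclidean ?L) Y (\<lambda>(c, f). \<lambda>z. c * f z)"
      using lc continuous_map_compose unfolding locally_convex_topology_on_def 
      by (fastforce simp: case_prod_unfold comp_def)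
  next
    have nb: "\<exists>U V. openin ?L U \<and> fun_convex V \<and> (\<lambda>_. 0) \<in> U \<and> U \<subseteq> V \<and> V \<subseteq> W"
      if "generate_topology_on S W" "(\<lambda>_. 0) \<in> W" for W
      using that
    proof (induction rule: generate_topology_on.induct)
      case Empty
      then show ?case by simp
    next
      case (Int a b)
      then obtain U V U' V' where
        "openin ?L U" "fun_convex V" "(\<lambda>_. 0) \<in> U" "U \<subseteq> V" "V \<subseteq> a"
        "openin ?L U'" "fun_convex V'" "(\<lambda>_. 0) \<in> U'" "U' \<subseteq> V'" "V' \<subseteq> b"
        by (metis IntE)
      then show ?case
        by (intro exI[of _ "U \<inter> U'"] exI[of _ "V \<inter> V'"]) (auto simp: fun_convex_def)
    next
      case (UN K)
      then obtain k where "k \<in> K" "(\<lambda>_. 0) \<in> k" by blast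
      then show ?case using UN.IH[of k] by (meson Union_upper order_trans)
    next
      case (Basis s)
      then obtain Y where Y: "Y \<in> \<Y>" "openin Y s" unfolding S_def by blast
      then have "neighbourhood_base_at (\<lambda>_. 0) fun_convex Y"
        unfolding \<Y>_def locally_convex_topology_on_def by blast
      then show ?case
        using Y Basis finer[OF Y(1)] unfolding neighbourhood_base_at_def by meson
    qed
    then show "neighbourhood_base_at (\<lambda>_. 0) fun_convex ?L"
      unfolding neighbourhood_base_at_def L openin_topology_generated_by_iff by blast
  qed
qed


lemma M_infty_bdd:
  assumes "f analytic_on ball 0 1" "r < 1"
  shows "bdd_above ((\<lambda>z. norm (f z)) ` sphere 0 r)"
proof -
  have "continuous_on (ball 0 1) f"
    using assms by (simp add: analytic_imp_holomorphic holomorphic_on_imp_continuous_on)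
  then have "continuous_on (sphere 0 r) f"
    by (rule continuous_on_subset) (use assms in auto)
  then have "compact ((\<lambda>z. norm (f z)) ` sphere 0 r)"
    by (intro compact_continuous_image continuous_on_norm) auto
  then show ?thesis by (simp add: bounded_imp_bdd_above compact_imp_bounded)
qed

lemma M_infty_le_iff:
  assumes "f analytic_on ball 0 1" "0 \<le> r" "r < 1"
  shows "M_infty f r \<le> C \<longleftrightarrow> (\<forall>z. norm z = r \<longrightarrow> norm (f z) \<le> C)"
proof -
  have "complex_of_real r \<in> sphere 0 r" using assms by simp
  then show ?thesis
    unfolding M_infty_def using cSUP_le_iff[OF _ M_infty_bdd[OF assms(1,3)]] by fastforce
qed

lemma A_minus_iff:
  "f \<in> A_minus \<mu> \<longleftrightarrow> f analytic_on ball 0 1 \<and> (\<forall>z. z \<notin> ball 0 1 \<longrightarrow> f z = 0) \<and>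
     (\<exists>C. \<forall>z\<in>ball 0 1. norm (f z) * (1 - norm z) powr \<mu> \<le> C)"
proof -
  have "bdd_above ((\<lambda>r. M_infty f r * (1 - r) powr \<mu>) ` {0..<1}) \<longleftrightarrow>
        (\<exists>C. \<forall>z\<in>ball 0 1. norm (f z) * (1 - norm z) powr \<mu> \<le> C)" if "f analytic_on ball 0 1"
  proof -
    have "M_infty f r * (1 - r) powr \<mu> \<le> C \<longleftrightarrow>
          (\<forall>z. norm z = r \<longrightarrow> norm (f z) * (1 - r) powr \<mu> \<le> C)" if "0 \<le> r" "r < 1" for r C
      using M_infty_le_iff[OF \<open>f analytic_on ball 0 1\<close> that, of "C / (1 - r) powr \<mu>"] that
      by (simp add: pos_le_divide_eq)
    then have "(\<forall>r\<in>{0..<1}. M_infty f r * (1 - r) powr \<mu> \<le> C) \<longleftrightarrow>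
               (\<forall>z\<in>ball 0 1. norm (f z) * (1 - norm z) powr \<mu> \<le> C)" for C
      by fastforce
    then show ?thesis by (simp add: bdd_above_def)
  qed
  then show ?thesis unfolding A_minus_def mem_Collect_eq by (metis (no_types, lifting))
qed

lemma A_minus_mono: "\<mu> \<le> \<nu> \<Longrightarrow> A_minus \<mu> \<subseteq> A_minus \<nu>"
proof
  fix f assume "\<mu> \<le> \<nu>" "f \<in> A_minus \<mu>"
  then obtain C where C: "\<And>z. z \<in> ball 0 1 \<Longrightarrow> norm (f z) * (1 - norm z) powr \<mu> \<le> C"
    unfolding A_minus_iff by blast
  have "norm (f z) * (1 - norm z) powr \<nu> \<le> C" if "z \<in> ball 0 1" for z
  proof -
    have "(1 - norm z) powr \<nu> \<le> (1 - norm z) powr \<mu>"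
      using that \<open>\<mu> \<le> \<nu>\<close> by (intro powr_mono') auto
    then show ?thesis using C[OF that] by (meson mult_left_mono norm_ge_zero order_trans)
  qed
  then show "f \<in> A_minus \<nu>" using \<open>f \<in> A_minus \<mu>\<close> unfolding A_minus_iff by blast
qed

lemma fun_subspace_A_minus: "fun_subspace (A_minus \<mu>)"
  unfolding fun_subspace_def
proof (intro conjI ballI allI)
  show "(\<lambda>_. 0) \<in> A_minus \<mu>" by (auto simp: A_minus_iff)
next
  fix f g assume fg: "f \<in> A_minus \<mu>" "g \<in> A_minus \<mu>"
  then obtain C D where C: "\<And>z. z \<in> ball 0 1 \<Longrightarrow> norm (f z) * (1 - norm z) powr \<mu> \<le> C"
    and D: "\<And>z. z \<in> ball 0 1 \<Longrightarrow> norm (g z) * (1 - norm z) powr \<mu> \<le> D"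
    unfolding A_minus_iff by blast
  have "norm (f z + g z) * (1 - norm z) powr \<mu> \<le> C + D" if "z \<in> ball 0 1" for z
  proof -
    have "norm (f z + g z) * (1 - norm z) powr \<mu> \<le> (norm (f z) + norm (g z)) * (1 - norm z) powr \<mu>"
      by (intro mult_right_mono norm_triangle_ineq) auto
    then show ?thesis using C[OF that] D[OF that] by (simp add: distrib_right)
  qed
  then show "(\<lambda>z. f z + g z) \<in> A_minus \<mu>"
    using fg unfolding A_minus_iff by (intro conjI exI[of _ "C + D"]) (auto intro!: analytic_on_add)
next
  fix c f assume f: "f \<in> A_minus \<mu>"
  then obtain C where C: "\<And>z. z \<in> ball 0 1 \<Longrightarrow> norm (f z) * (1 - norm z) powr \<mu> \<le> C"
    unfolding A_minus_iff by blast
  have "norm (c * f z) * (1 - norm z) powr \<mu> \<le> norm c * C" if "z \<in> ball 0 1" for z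
    using mult_left_mono[OF C[OF that], of "norm c"] by (simp add: norm_mult mult.assoc)
  then show "(\<lambda>z. c * f z) \<in> A_minus \<mu>"
    using f unfolding A_minus_iff
    by (intro conjI exI[of _ "norm c * C"]) (auto intro!: analytic_on_mult)
qed

lemma fun_subspace_linf:
  assumes w: "\<And>j. 0 \<le> w j" shows "fun_subspace (linf w)"
  unfolding fun_subspace_def linf_def mem_Collect_eq
proof (intro conjI ballI allI; (unfold mem_Collect_eq)?)
  fix x y :: "nat \<Rightarrow> complex" assume "bdd_above (range (\<lambda>j. w j * norm (x j)))" "bdd_above (range (\<lambda>j. w j * norm (y j)))"
  then obtain C D where "\<And>j. w j * norm (x j) \<le> C" "\<And>j. w j * norm (y j) \<le> D"
    unfolding bdd_above_def by blast
  moreover have "w j * norm (x j + y j) \<le> w j * norm (x j) + w j * norm (y j)" for j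
    using w mult_left_mono[OF norm_triangle_ineq[of "x j" "y j"], of "w j"]
    by (simp add: distrib_left)
  ultimately have "w j * norm (x j + y j) \<le> C + D" for j
    by (meson add_mono order_trans)
  then show "bdd_above (range (\<lambda>j. w j * norm (x j + y j)))" unfolding bdd_above_def by blast
next
  fix c and x :: "nat \<Rightarrow> complex" assume "bdd_above (range (\<lambda>j. w j * norm (x j)))"
  then obtain C where C: "\<And>j. w j * norm (x j) \<le> C" unfolding bdd_above_def by blast
  have "w j * norm (c * x j) \<le> norm c * C" for j
    using mult_left_mono[OF C, of "norm c"] by (simp add: norm_mult mult_ac)
  then show "bdd_above (range (\<lambda>j. w j * norm (c * x j)))" unfolding bdd_above_def by blast
qed simp

lemma fun_subspace_UN:
  assumes "I \<noteq> {}" and "\<And>i. i \<in> I \<Longrightarrow> fun_subspace (E i)"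
    and "\<And>i j. \<lbrakk>i \<in> I; j \<in> I\<rbrakk> \<Longrightarrow> E i \<subseteq> E j \<or> E j \<subseteq> E i"
  shows "fun_subspace (\<Union>i\<in>I. E i)"
  unfolding fun_subspace_def
proof (intro conjI ballI allI)
  show "(\<lambda>_. 0) \<in> (\<Union>i\<in>I. E i)" using assms(1,2) unfolding fun_subspace_def by blast
next
  fix f g assume "f \<in> (\<Union>i\<in>I. E i)" "g \<in> (\<Union>i\<in>I. E i)"
  then obtain i where "i \<in> I" "f \<in> E i" "g \<in> E i" using assms(3) by blast
  then show "(\<lambda>z. f z + g z) \<in> (\<Union>i\<in>I. E i)" using assms(2) unfolding fun_subspace_def by blast
next
  fix c f assume "f \<in> (\<Union>i\<in>I. E i)"
  then show "(\<lambda>z. c * f z) \<in> (\<Union>i\<in>I. E i)" using assms(2) unfolding fun_subspace_def by blast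
qed

lemma s_weight_pos: "0 < \<mu> \<Longrightarrow> 0 < s_weight \<mu> j"
  by (auto simp: s_weight_def intro!: divide_pos_pos)

lemma s_weight_antimono:
  assumes "0 < \<mu>" "\<mu> \<le> \<nu>"
  shows "s_weight \<nu> j \<le> s_weight \<mu> j"
proof -
  define x where "x = real j"
  have x: "0 \<le> x" unfolding x_def by simp
  have "(ln \<nu> - ln (x + \<nu>)) * \<nu> \<le> (ln \<mu> - ln (x + \<mu>)) * \<mu>"
  proof (rule DERIV_nonpos_imp_nonincreasing[OF assms(2)])
    fix t assume "\<mu> \<le> t" "t \<le> \<nu>"
    then have t: "0 < t" using assms by simp
    have "((\<lambda>t. (ln t - ln (x + t)) * t) has_real_derivative
             (1 / t - 1 / (x + t)) * t + (ln t - ln (x + t))) (at t)"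
      using t x by (auto intro!: derivative_eq_intros)
    moreover have "ln t - ln (x + t) \<le> t / (x + t) - 1"
      using t x ln_le_minus_one[of "t / (x + t)"] by (simp add: ln_div)
    moreover have "(1 / t - 1 / (x + t)) * t = 1 - t / (x + t)"
      using t x by (simp add: left_diff_distrib)
    ultimately show "\<exists>y. ((\<lambda>t. (ln t - ln (x + t)) * t) has_real_derivative y) (at t) \<and> y \<le> 0"
      by (intro exI conjI) auto
  qed
  then have "ln (\<nu> / (x + \<nu>)) * \<nu> \<le> ln (\<mu> / (x + \<mu>)) * \<mu>"
    using assms x by (simp add: ln_div)
  then show ?thesis
    using assms x by (auto simp: s_weight_def powr_def mult.commute simp flip: x_def)
qed

lemma topspace_A_minus: "topspace (A_minus_topology \<mu>) = A_minus \<mu>"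
  unfolding A_minus_topology_def by (rule topspace_seminorm_topology) (auto simp: growth_norm_zero)

lemma topspace_A_plus: "topspace (A_plus_topology \<gamma>) = A_plus \<gamma>"
  unfolding A_plus_topology_def by (rule topspace_seminorm_topology) (auto simp: growth_norm_zero)

lemma topspace_linf: "topspace (linf_topology w) = linf w"
  unfolding linf_topology_def by (rule topspace_seminorm_topology) (auto simp: linf_norm_zero)

lemma topspace_kothe_echelon:
  "K \<noteq> {} \<Longrightarrow> topspace (kothe_echelon_topology K a) = kothe_echelon K a"
  unfolding kothe_echelon_topology_def
  by (rule topspace_seminorm_topology) (auto simp: linf_norm_zero)

lemma topspace_A_union:
  assumes "0 < \<gamma>" shows "topspace (A_union_topology \<gamma>) = A_union \<gamma>"
proof -
  have "fun_subspace (\<Union>\<mu>\<in>{0<..<\<gamma>}. A_minus \<mu>)"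
    using assms fun_subspace_A_minus
    by (intro fun_subspace_UN) (meson A_minus_mono linear | simp)+
  then show ?thesis
    using lc_inductive_topology_finest(1)[of A_minus_topology "{0<..<\<gamma>}"]
    by (simp add: A_union_topology_def A_union_def topspace_A_minus locally_convex_topology_on_def)
qed

lemma linf_mono:
  assumes "\<And>j. v j \<le> w j" shows "linf w \<subseteq> linf v"
proof
  fix x assume "x \<in> linf w"
  then obtain C where "\<And>j. w j * norm (x j) \<le> C" unfolding linf_def bdd_above_def by blast
  then have "\<And>j. v j * norm (x j) \<le> C"
    by (meson assms mult_right_mono norm_ge_zero order_trans)
  then show "x \<in> linf v" unfolding linf_def bdd_above_def by blast
qed

lemma topspace_kothe_coechelon:
  assumes "K \<noteq> {}" and "\<And>k j. k \<in> K \<Longrightarrow> 0 < v k j"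
    and decr: "\<And>k l j. \<lbrakk>k \<in> K; l \<in> K; k \<le> l\<rbrakk> \<Longrightarrow> v l j \<le> v k j"
  shows "topspace (kothe_coechelon_topology K v) = kothe_coechelon K v"
proof -
  have "fun_subspace (\<Union>k\<in>K. linf (v k))"
  proof (rule fun_subspace_UN)
    show "fun_subspace (linf (v k))" if "k \<in> K" for k
      using assms(2)[OF that] by (intro fun_subspace_linf less_imp_le)
    show "linf (v k) \<subseteq> linf (v l) \<or> linf (v l) \<subseteq> linf (v k)" if "k \<in> K" "l \<in> K" for k l
      using that decr linf_mono[of "v k" "v l"] linf_mono[of "v l" "v k"] by (meson linear)
  qed fact
  then show ?thesis
    using lc_inductive_topology_finest(1)[of "\<lambda>k. linf_topology (v k)" K]
    by (simp add: kothe_coechelon_topology_def kothe_coechelon_def topspace_linf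
        locally_convex_topology_on_def)
qed

end

theory Submission
  imports Defs "HOL-Complex_Analysis.Complex_Analysis" "HOL-Library.Discrete_Functions"
begin

text \<open>
  Split the Taylor coefficients of \<open>f\<close> into the dyadic blocks \<open>N - 1 \<le> i < 2 N - 1\<close>, \<open>N = 2\<^sup>n\<close>, and
  apply a discrete Fourier transform of size \<open>N\<close> to each block, i.e. record the values of the block
  polynomial at the \<open>N\<close>-th roots of unity. This is a linear bijection on all coefficient sequences
  that does not depend on \<open>\<mu>\<close>. In either direction the \<open>L\<^sup>1\<close>-norms of the Dirichlet kernels cost only a
  factor \<open>O(N powr \<epsilon>)\<close> on the block of size \<open>N\<close>, where \<open>s\<^sub>\<mu>\<close> is of order \<open>N powr - \<mu>\<close>. Hence the
  transform is bounded from \<open>A\<^sup>-\<^sup>\<mu>\<close> to \<open>\<ell>\<^sub>\<infinity>(s\<^sub>\<nu>)\<close>, and its inverse from \<open>\<ell>\<^sub>\<infinity>(s\<^sub>\<mu>)\<close> to \<open>A\<^sup>-\<^sup>\<nu>\<close>, whenever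
  \<open>\<mu> < \<nu>\<close>, and this loss disappears in the projective and inductive limits.
\<close>

section \<open>Linear maps and locally convex topologies\<close>

text \<open>Taylor coefficients themselves are bad coordinates: from
  \<open>norm (a i) \<le> C * i powr \<mu>\<close> one only gets growth of order (1 - r) powr
  -(\<mu> + 1), and the loss of a whole power would survive the limits. Samples avoid this: z^(N-1)
  p(z) with deg p < N is determined by its values at the N-th roots of unity, and its maximum on the
  unit circle exceeds the largest sample by at most a Lebesgue constant. Dyadic blocks fit the
  weights. At the radius N/(N+1) the bound for f is of order N powr \<mu>, and moving a power at
  most N from there to the unit circle costs at most (1 + 1/N)^N \<le> e \<le> 3; this is the origin
  of that radius and of the factors 3. Conversely, the block of size N carries the factor |z|^(N-1),
  which against (1 - |z|) powr \<nu> yields N powr -\<nu>, so that the blocks can be summed as a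
  geometric series. On the topological side only these norm bounds enter. Comparison of seminorms
  settles the intersections; for the unions, a pullback topology gives the universal property of the
  finest locally convex topology.\<close>

definition fun_linear_on :: "('a \<Rightarrow> complex) set \<Rightarrow> (('a \<Rightarrow> complex) \<Rightarrow> 'b \<Rightarrow> complex) \<Rightarrow> bool" where
  "fun_linear_on E T \<longleftrightarrow> (\<forall>f\<in>E. \<forall>g\<in>E. T (\<lambda>z. f z + g z) = (\<lambda>j. T f j + T g j)) \<and>
     (\<forall>c. \<forall>f\<in>E. T (\<lambda>z. c * f z) = (\<lambda>j. c * T f j))"

lemma fun_linear_on_subset: "fun_linear_on E T \<Longrightarrow> D \<subseteq> E \<Longrightarrow> fun_linear_on D T"
  unfolding fun_linear_on_def by blast

lemma fun_subspace_diff: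
  assumes "fun_subspace E" "f \<in> E" "g \<in> E"
  shows "(\<lambda>z. f z - g z) \<in> E"
proof -
  have "(\<lambda>z. - 1 * g z) \<in> E"
    using assms unfolding fun_subspace_def by blast
  then have "(\<lambda>z. f z + - 1 * g z) \<in> E"
    using assms(1,2) unfolding fun_subspace_def by fast
  then show ?thesis by simp
qed

lemma fun_linear_on_diff:
  assumes "fun_linear_on E T" "fun_subspace E" "f \<in> E" "g \<in> E"
  shows "T (\<lambda>z. f z - g z) = (\<lambda>j. T f j - T g j)"
proof -
  have "(\<lambda>z. - 1 * g z) \<in> E"
    using assms unfolding fun_subspace_def by blast
  then have "T (\<lambda>z. f z + - 1 * g z) = (\<lambda>j. T f j + T (\<lambda>z. - 1 * g z) j)"
    using assms unfolding fun_linear_on_def by fast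
  moreover have "T (\<lambda>z. - 1 * g z) = (\<lambda>j. - 1 * T g j)"
    using assms unfolding fun_linear_on_def by blast
  ultimately show ?thesis by simp
qed

text \<open>Spares a direct proof that \<open>synthesis_map\<close>, an infinite series, is linear:
  linearity is inherited from \<open>analysis_map\<close> through the two inverse
  identities.\<close>

lemma fun_linear_on_inverse:
  assumes lin: "fun_linear_on E T" and E: "fun_subspace E"
    and S: "S \<in> F \<rightarrow> E" "\<And>x. x \<in> F \<Longrightarrow> T (S x) = x" "\<And>f. f \<in> E \<Longrightarrow> S (T f) = f"
  shows "fun_linear_on F S"
  unfolding fun_linear_on_def
proof (intro conjI ballI allI)
  fix x y assume xy: "x \<in> F" "y \<in> F"
  then have SE: "S x \<in> E" "S y \<in> E" using S(1) by auto
  then have "(\<lambda>z. S x z + S y z) \<in> E" using E unfolding fun_subspace_def by blast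
  then have "S (T (\<lambda>z. S x z + S y z)) = (\<lambda>z. S x z + S y z)" by (rule S(3))
  moreover have "T (\<lambda>z. S x z + S y z) = (\<lambda>j. x j + y j)"
    using lin SE xy S(2) unfolding fun_linear_on_def by simp
  ultimately show "S (\<lambda>z. x z + y z) = (\<lambda>j. S x j + S y j)" by simp
next
  fix c x assume x: "x \<in> F"
  then have SE: "S x \<in> E" using S(1) by auto
  then have "(\<lambda>z. c * S x z) \<in> E" using E unfolding fun_subspace_def by blast
  then have "S (T (\<lambda>z. c * S x z)) = (\<lambda>z. c * S x z)" by (rule S(3))
  moreover have "T (\<lambda>z. c * S x z) = (\<lambda>j. c * x j)"
    using lin SE x S(2) unfolding fun_linear_on_def by simp
  ultimately show "S (\<lambda>z. c * x z) = (\<lambda>j. c * S x j)" by simp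
qed

text \<open>The usual criterion that each target seminorm is dominated by a source seminorm. It
  suffices to treat the preimages of subbasic balls; their centre h need not lie in the range of T,
  so subadditivity of q is used to pass from T f to h.\<close>

lemma continuous_map_seminorm_topology:
  assumes E: "fun_subspace E" and F: "fun_subspace F"
    and lin: "fun_linear_on E T" and T: "T \<in> E \<rightarrow> F"
    and p0: "I \<noteq> {}" "\<And>i. i \<in> I \<Longrightarrow> p i (\<lambda>_. 0) = 0"
    and q0: "J \<noteq> {}" "\<And>j. j \<in> J \<Longrightarrow> q j (\<lambda>_. 0) = 0"
    and q: "\<And>j x y. j \<in> J \<Longrightarrow> x \<in> F \<Longrightarrow> y \<in> F \<Longrightarrow> q j (\<lambda>z. x z + y z) \<le> q j x + q j y"
    and bd: "\<And>j. j \<in> J \<Longrightarrow> \<exists>i\<in>I. \<exists>C>0. \<forall>f\<in>E. q j (T f) \<le> C * p i f"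
  shows "continuous_map (seminorm_topology E I p) (seminorm_topology F J q) T"
proof -
  let ?X = "seminorm_topology E I p"
  have tX: "topspace ?X = E" and tY: "topspace (seminorm_topology F J q) = F"
    by (rule topspace_seminorm_topology; use p0 q0 in blast)+
  have "openin ?X (T -` U \<inter> E)"
    if U: "U \<in> {{g\<in>F. q i (\<lambda>z. g z - f z) < e} | i f e. i \<in> J \<and> f \<in> F \<and> e > 0}" for U
  proof (subst openin_subopen, safe)
    obtain j h e where j: "j \<in> J" "h \<in> F" "e > 0" and Ueq: "U = {g\<in>F. q j (\<lambda>z. g z - h z) < e}"
      using U by blast
    fix f assume f: "f \<in> E" "T f \<in> U"
    obtain i C where i: "i \<in> I" and C: "C > 0" "\<And>f. f \<in> E \<Longrightarrow> q j (T f) \<le> C * p i f"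
      using bd[OF j(1)] by blast
    \<comment> \<open>The room that T f leaves inside the ball around h, divided by the operator
      bound.\<close>
    define d where "d = (e - q j (\<lambda>z. T f z - h z)) / C"
    have d: "d > 0" using f(2) C(1) unfolding d_def Ueq by simp
    let ?B = "{g\<in>E. p i (\<lambda>z. g z - f z) < d}"
    have "openin ?X ?B" unfolding seminorm_topology_def
      by (rule topology_generated_by_Basis) (use i f(1) d in blast)
    moreover have "f \<in> ?B" using f(1) d i p0(2) by simp
    moreover have "?B \<subseteq> T -` U \<inter> E"
    proof
      fix g assume g: "g \<in> ?B"
      then have gE: "g \<in> E" by blast
      have TF: "T f \<in> F" "T g \<in> F" using T f(1) gE by auto
      have "(\<lambda>z. g z - f z) \<in> E" using fun_subspace_diff E gE f(1) by blast
      then have "q j (\<lambda>z. T g z - T f z) \<le> C * p i (\<lambda>z. g z - f z)"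
        using C(2) fun_linear_on_diff[OF lin E gE f(1)] by metis
      also have "\<dots> < C * d" using g C(1) by simp
      finally have "q j (\<lambda>z. T g z - T f z) + q j (\<lambda>z. T f z - h z) < e"
        using C(1) by (simp add: d_def)
      moreover have "q j (\<lambda>z. (T g z - T f z) + (T f z - h z))
          \<le> q j (\<lambda>z. T g z - T f z) + q j (\<lambda>z. T f z - h z)"
        by (rule q[OF j(1)]) (rule fun_subspace_diff[OF F]; use TF j in blast)+
      ultimately show "g \<in> T -` U \<inter> E" using gE TF by (auto simp: Ueq)
    qed
    ultimately show "\<exists>S. openin ?X S \<and> f \<in> S \<and> S \<subseteq> T -` U \<inter> E" by blast
  qed
  then show ?thesis
    unfolding seminorm_topology_def[of F]
    by (intro continuous_on_generated_topo)
      (use tX tY T in \<open>auto simp: seminorm_topology_def[of F]\<close>)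
qed

text \<open>Supplies the competitor against which the finest locally convex topology on E is tested.
  The operations stay continuous because T intertwines them, and convex neighbourhoods of 0 pull
  back to convex ones since T is linear with T 0 = 0.\<close>

lemma locally_convex_topology_on_pullback:
  assumes Y: "locally_convex_topology_on F Y" and E: "fun_subspace E"
    and lin: "fun_linear_on E T" and T: "T \<in> E \<rightarrow> F"
  shows "locally_convex_topology_on E (pullback_topology E T Y)"
  unfolding locally_convex_topology_on_def
proof (intro conjI)
  let ?P = "pullback_topology E T Y"
  have tY: "topspace Y = F"
    and add: "continuous_map (prod_topology Y Y) Y (\<lambda>(f, g). \<lambda>z. f z + g z)"
    and scale: "continuous_map (prod_topology euclidean Y) Y (\<lambda>(c, f). \<lambda>z. c * f z)"
    and base: "neighbourhood_base_at (\<lambda>_. 0) fun_convex Y"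
    using Y unfolding locally_convex_topology_on_def by auto
  show tP: "topspace ?P = E" using T tY by (auto simp: topspace_pullback_topology)
  have cT: "continuous_map ?P Y T"
    using continuous_map_pullback[of Y Y id E T] by simp
  have "continuous_map (prod_topology ?P ?P) (prod_topology Y Y) (\<lambda>(f, g). (T f, T g))"
    using cT by (subst continuous_map_prod_top) auto
  from continuous_map_compose[OF this add]
  have c: "continuous_map (prod_topology ?P ?P) Y (\<lambda>(f, g). \<lambda>z. T f z + T g z)"
    by (simp add: comp_def case_prod_unfold)
  show "continuous_map (prod_topology ?P ?P) ?P (\<lambda>(f, g). \<lambda>z. f z + g z)"
  proof (rule continuous_map_pullback')
    show "continuous_map (prod_topology ?P ?P) Y (T \<circ> (\<lambda>(f, g). \<lambda>z. f z + g z))"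
      by (rule continuous_map_eq[OF c]) (use lin tP in \<open>auto simp: fun_linear_on_def\<close>)
    show "topspace (prod_topology ?P ?P) \<subseteq> (\<lambda>(f, g). \<lambda>z. f z + g z) -` E"
      using E tP by (auto simp: fun_subspace_def)
  qed
  have "continuous_map (prod_topology euclidean ?P) (prod_topology euclidean Y) (\<lambda>(c :: complex, g). (c, T g))"
    using cT by (subst continuous_map_prod_top) auto
  from continuous_map_compose[OF this scale]
  have c: "continuous_map (prod_topology euclidean ?P) Y (\<lambda>(c, f). \<lambda>z. c * T f z)"
    by (simp add: comp_def case_prod_unfold)
  show "continuous_map (prod_topology euclidean ?P) ?P (\<lambda>(c, f). \<lambda>z. c * f z)"
  proof (rule continuous_map_pullback')
    show "continuous_map (prod_topology euclidean ?P) Y (T \<circ> (\<lambda>(c, f). \<lambda>z. c * f z))"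
      by (rule continuous_map_eq[OF c]) (use lin tP in \<open>auto simp: fun_linear_on_def\<close>)
    show "topspace (prod_topology euclidean ?P) \<subseteq> (\<lambda>(c, f). \<lambda>z. c * f z) -` E"
      using E tP by (auto simp: fun_subspace_def)
  qed
  have E0: "(\<lambda>_. 0) \<in> E" using E unfolding fun_subspace_def by blast
  then have T0: "T (\<lambda>_. 0) = (\<lambda>_. 0)"
    using fun_linear_on_diff[OF lin E E0 E0] by simp
  show "neighbourhood_base_at (\<lambda>_. 0) fun_convex ?P"
    unfolding neighbourhood_base_at_def
  proof (intro allI impI, elim conjE)
    fix W assume "openin ?P W" "(\<lambda>_. 0) \<in> W"
    then obtain W' where W': "openin Y W'" "W = T -` W' \<inter> E"
      unfolding openin_pullback_topology by blast
    with \<open>(\<lambda>_. 0) \<in> W\<close> T0 have "(\<lambda>_. 0) \<in> W'" by auto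
    then obtain U V where UV: "openin Y U" "fun_convex V" "(\<lambda>_. 0) \<in> U" "U \<subseteq> V" "V \<subseteq> W'"
      using base W'(1) unfolding neighbourhood_base_at_def by meson
    have "fun_convex (T -` V \<inter> E)"
      unfolding fun_convex_def
    proof (intro ballI)
      fix f g and t :: real assume fg: "f \<in> T -` V \<inter> E" "g \<in> T -` V \<inter> E" and t: "t \<in> {0..1}"
      have s: "(\<lambda>z. of_real (1 - t) * f z) \<in> E" "(\<lambda>z. of_real t * g z) \<in> E"
        using fg E unfolding fun_subspace_def by blast+
      have "\<And>u v. u \<in> E \<Longrightarrow> v \<in> E \<Longrightarrow> (\<lambda>z. u z + v z) \<in> E"
        using E unfolding fun_subspace_def by blast
      from this[OF s] have "(\<lambda>z. of_real (1 - t) * f z + of_real t * g z) \<in> E" .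
      moreover have "T (\<lambda>z. of_real (1 - t) * f z + of_real t * g z)
          = (\<lambda>z. T (\<lambda>z. of_real (1 - t) * f z) z + T (\<lambda>z. of_real t * g z) z)"
        using s lin unfolding fun_linear_on_def by simp
      moreover have "T (\<lambda>z. of_real (1 - t) * f z) = (\<lambda>z. of_real (1 - t) * T f z)"
        "T (\<lambda>z. of_real t * g z) = (\<lambda>z. of_real t * T g z)"
        using fg lin unfolding fun_linear_on_def by blast+
      moreover have "(\<lambda>z. of_real (1 - t) * T f z + of_real t * T g z) \<in> V"
        using UV(2) fg t unfolding fun_convex_def by blast
      ultimately show "(\<lambda>z. of_real (1 - t) * f z + of_real t * g z) \<in> T -` V \<inter> E"
        by simp
    qed
    moreover have "openin ?P (T -` U \<inter> E)"
      using UV(1) unfolding openin_pullback_topology by blast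
    ultimately show "\<exists>U V. openin ?P U \<and> fun_convex V \<and> (\<lambda>_. 0) \<in> U \<and> U \<subseteq> V \<and> V \<subseteq> W"
      using UV T0 E0 W'(2)
      by (intro exI[of _ "T -` U \<inter> E"] exI[of _ "T -` V \<inter> E"]) auto
  qed
qed

text \<open>Universal property of the inductive limit: the pullback of the target topology along T
  is locally convex on E and makes every inclusion of a step continuous, hence it is coarser than
  the finest such topology, which says that T is continuous.\<close>

lemma continuous_map_lc_inductive_topology:
  fixes I :: "'i set" and J :: "'j set"
    and X :: "'i \<Rightarrow> ('a \<Rightarrow> complex) topology" and Y :: "'j \<Rightarrow> ('b \<Rightarrow> complex) topology"
  defines "E \<equiv> (\<Union>i\<in>I. topspace (X i))" and "F \<equiv> (\<Union>j\<in>J. topspace (Y j))"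
  assumes E: "fun_subspace E" and F: "fun_subspace F"
    and lin: "fun_linear_on E T"
    and step: "\<And>i. i \<in> I \<Longrightarrow> \<exists>j\<in>J. continuous_map (X i) (Y j) T"
  shows "continuous_map (lc_inductive_topology I X) (lc_inductive_topology J Y) T"
proof -
  let ?X = "lc_inductive_topology I X" and ?Y = "lc_inductive_topology J Y"
  let ?P = "pullback_topology E T ?Y"
  note finX = lc_inductive_topology_finest[where I = I and X = X, folded E_def, OF E]
  note finY = lc_inductive_topology_finest[where I = J and X = Y, folded F_def, OF F]
  have tX: "topspace ?X = E" using finX(1) unfolding locally_convex_topology_on_def by blast
  have c: "continuous_map (X i) ?Y T" if i: "i \<in> I" for i
  proof -
    obtain j where "j \<in> J" "continuous_map (X i) (Y j) T" using step[OF i] by blast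
    then show ?thesis
      using continuous_map_compose[OF _ finY(2), of "X i" j T] by (simp add: comp_def)
  qed
  have T: "T \<in> E \<rightarrow> F"
  proof
    fix f assume "f \<in> E"
    then obtain i where "i \<in> I" "f \<in> topspace (X i)" unfolding E_def by blast
    then show "T f \<in> F"
      using c finY(1) unfolding continuous_map_def locally_convex_topology_on_def by auto
  qed
  have P: "locally_convex_topology_on E ?P"
    by (rule locally_convex_topology_on_pullback[OF finY(1) E lin T])
  \<comment> \<open>Continuity of an inclusion into the pullback topology is just continuity of T on
    that step.\<close>
  have cP: "continuous_map (X i) ?P (\<lambda>f. f)" if "i \<in> I" for i
    by (rule continuous_map_pullback') (use c[OF that] that in \<open>auto simp: comp_def E_def\<close>)
  show ?thesis
    unfolding continuous_map_alt
  proof (intro conjI allI impI)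
    show "T \<in> topspace ?X \<rightarrow> topspace ?Y"
      using T tX finY(1) unfolding locally_convex_topology_on_def by blast
    fix U assume "openin ?Y U"
    then have "openin ?P (T -` U \<inter> E)" unfolding openin_pullback_topology by blast
    then show "openin ?X (T -` U \<inter> topspace ?X)"
      using finX(3)[OF P cP] tX by simp
  qed
qed

lemma tvs_isomorphicI:
  assumes "continuous_map X Y T" "continuous_map Y X S" "fun_linear_on (topspace X) T"
    and "\<And>f. f \<in> topspace X \<Longrightarrow> S (T f) = f" "\<And>x. x \<in> topspace Y \<Longrightarrow> T (S x) = x"
  shows "tvs_isomorphic X Y"
proof -
  have "homeomorphic_maps X Y T S" using assms unfolding homeomorphic_maps_def by blast
  then show ?thesis
    using assms(3) homeomorphic_maps_map unfolding tvs_isomorphic_def fun_linear_on_def by blast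
qed

section \<open>Dirichlet kernels and the blockwise Fourier transform\<close>

text \<open>Telescoping: each term is at most (q powr \<epsilon> - (q - 1) powr \<epsilon>) /
  \<epsilon>.\<close>

lemma sum_powr_minus_le:
  assumes "0 < \<epsilon>" "\<epsilon> \<le> 1"
  shows "(\<Sum>q=1..n. real q powr (\<epsilon> - 1)) \<le> real n powr \<epsilon> / \<epsilon>"
proof (induction n)
  case (Suc n)
  define q where "q = real (Suc n)"
  have q: "q \<ge> 1" and n: "real n = q - 1" unfolding q_def by auto
  \<comment> \<open>Bernoulli's inequality (1 - 1/q) powr \<epsilon> \<le> 1 - \<epsilon>/q, read
    off from Young's inequality with weights \<epsilon> and 1 - \<epsilon>. Young needs a positive
    base, so q = 1 is separate.\<close>
  have "(1 - 1 / q) powr \<epsilon> * 1 powr (1 - \<epsilon>) \<le> \<epsilon> * (1 - 1 / q) + (1 - \<epsilon>) * 1"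
  proof (cases "q = 1")
    case False
    then show ?thesis using assms q by (intro Youngs_inequality_0) auto
  qed (use assms in auto)
  then have "q powr \<epsilon> * (1 - 1 / q) powr \<epsilon> \<le> q powr \<epsilon> * (1 - \<epsilon> / q)"
    by (intro mult_left_mono) (auto simp: algebra_simps)
  moreover have "q powr \<epsilon> * (1 - 1 / q) powr \<epsilon> = (q - 1) powr \<epsilon>"
  proof -
    have "q * (1 - 1 / q) = q - 1" using q by (simp add: right_diff_distrib)
    then show ?thesis using powr_mult[of q "1 - 1 / q" \<epsilon>] q by simp
  qed
  moreover have "q powr \<epsilon> * (1 - \<epsilon> / q) = q powr \<epsilon> - \<epsilon> * q powr (\<epsilon> - 1)"
    using q by (simp add: powr_diff field_simps)
  ultimately have "real n powr \<epsilon> \<le> q powr \<epsilon> - \<epsilon> * q powr (\<epsilon> - 1)"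
    using n by simp
  then have "q powr (\<epsilon> - 1) \<le> (q powr \<epsilon> - real n powr \<epsilon>) / \<epsilon>"
    using assms by (simp add: pos_le_divide_eq mult.commute)
  then show ?case using Suc.IH by (simp add: q_def diff_divide_distrib)
qed simp

text \<open>The chord has length 2 |sin (\<pi> s)|, and concavity of the sine gives sin (\<pi> s)
  \<ge> 2 s for s \<le> 1/2 (Jordan's inequality). The other half follows by complex
  conjugation.\<close>

lemma norm_cis_minus_one_ge:
  assumes "0 \<le> s" "s \<le> 1"
  shows "2 * min s (1 - s) \<le> norm (cis (2 * pi * s) - 1)"
proof -
  have *: "2 * s \<le> norm (cis (2 * pi * s) - 1)" if s: "0 \<le> s" "s \<le> 1 / 2" for s :: real
  proof -
    have "convex_on {0..pi/2} (\<lambda>x. - sin x)"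
    proof (rule f''_ge0_imp_convex[where f' = "\<lambda>x. - cos x" and f'' = sin])
      show "0 \<le> sin x" if "x \<in> {0..pi/2}" for x
        using that by (intro sin_ge_zero) auto
    qed (auto intro!: derivative_eq_intros)
    from convex_onD[OF this, of "2 * s" 0 "pi/2"] s
    have "2 * s \<le> sin (pi * s)" by (simp add: mult.commute)
    moreover have "norm (cis (2 * pi * s) - 1) = 2 * \<bar>sin (pi * s)\<bar>"
    proof -
      have "cis (2 * pi * s) - 1 = cis (pi * s) * (2 * \<i> * sin (pi * s))"
        by (simp add: complex_eq_iff cos_double_sin sin_double mult.assoc power2_eq_square)
      then show ?thesis by (simp add: norm_mult)
    qed
    ultimately show ?thesis using s by linarith
  qed
  show ?thesis
  proof (cases "s \<le> 1 / 2")
    case False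
    have "2 * (1 - s) \<le> norm (cis (2 * pi * (1 - s)) - 1)" using False assms by (intro *) auto
    also have "cis (2 * pi * (1 - s)) = cnj (cis (2 * pi * s))"
      by (simp add: complex_eq_iff cos_diff sin_diff right_diff_distrib)
    also have "norm (\<dots> - 1) = norm (cis (2 * pi * s) - 1)"
      by (metis complex_cnj_diff complex_cnj_one complex_mod_cnj)
    finally show ?thesis by (auto simp: min_def)
  qed (use *[of s] assms in \<open>auto simp: min_def\<close>)
qed

text \<open>The one-sided Dirichlet kernel, a geometric sum; over a block of exponents it appears
  multiplied by u^(N-1).\<close>

definition dirichlet_poly :: "nat \<Rightarrow> complex \<Rightarrow> complex" where
  "dirichlet_poly N u = (\<Sum>k<N. u ^ k)"

lemma dirichlet_poly_bounds:
  assumes "N \<ge> 1" "0 \<le> \<rho>" "\<rho> \<le> 1 + 1 / real N" "norm \<zeta> = 1"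
  shows "norm (dirichlet_poly N (of_real \<rho> * \<zeta>)) \<le> 8 * N"
    and "norm (dirichlet_poly N (of_real \<rho> * \<zeta>)) * norm (\<zeta> - 1) \<le> 8"
proof -
  let ?u = "of_real \<rho> * \<zeta>" and ?D = "dirichlet_poly N (of_real \<rho> * \<zeta>)"
  have u: "norm ?u = \<rho>" using assms by (simp add: norm_mult)
  have "(1 + 1 / real N) ^ N \<le> exp (1 / real N) ^ N"
    by (intro power_mono exp_ge_add_one_self) auto
  also have "\<dots> = exp 1"
    using assms(1) by (simp flip: exp_of_nat_mult)
  finally have e: "(1 + 1 / real N) ^ N \<le> 3" using exp_le by linarith
  have p: "\<rho> ^ k \<le> 3" if "k \<le> N" for k
  proof -
    have "\<rho> ^ k \<le> (1 + 1 / real N) ^ k" using assms by (intro power_mono) auto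
    also have "\<dots> \<le> (1 + 1 / real N) ^ N" using that by (intro power_increasing) auto
    finally show ?thesis using e by linarith
  qed
  have "norm ?D \<le> (\<Sum>k<N. 3)"
    unfolding dirichlet_poly_def by (rule sum_norm_le) (use p u in \<open>auto simp: norm_power\<close>)
  then show "norm ?D \<le> 8 * N" by simp
  have "?D * (1 - ?u) = 1 - ?u ^ N"
    unfolding dirichlet_poly_def by (simp add: one_diff_power_eq mult.commute)
  then have "norm ?D * norm (1 - ?u) = norm (1 - ?u ^ N)" by (metis norm_mult)
  also have "\<dots> \<le> 1 + \<rho> ^ N" using norm_triangle_ineq4[of 1 "?u ^ N"] u by (simp add: norm_power)
  finally have D: "norm ?D * norm (1 - ?u) \<le> 4" using p[of N] by simp
  \<comment> \<open>u and \<zeta> lie on one ray, so |u - \<zeta>| = | |u| - 1 | \<le> |u - 1| and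
    thus |\<zeta> - 1| \<le> 2 |u - 1|: the geometric sum formula at u gives the bound in terms of
    \<zeta>.\<close>
  have "norm (?u - \<zeta>) = \<bar>\<rho> - 1\<bar>"
    using assms norm_mult[of "of_real \<rho> - 1" \<zeta>] by (simp add: left_diff_distrib flip: of_real_diff)
       (metis norm_of_real of_real_1 of_real_diff)
  also have "\<dots> \<le> norm (?u - 1)" using norm_triangle_ineq3[of ?u 1] u by simp
  finally have "norm (\<zeta> - 1) \<le> 2 * norm (1 - ?u)"
    using norm_triangle_ineq[of "\<zeta> - ?u" "?u - 1"] by (simp add: norm_minus_commute)
  then have "norm ?D * norm (\<zeta> - 1) \<le> norm ?D * (2 * norm (1 - ?u))"
    by (intro mult_left_mono) auto
  also have "\<dots> = 2 * (norm ?D * norm (1 - ?u))" by (simp only: mult_ac)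
  also have "\<dots> \<le> 8" using D by linarith
  finally show "norm ?D * norm (\<zeta> - 1) \<le> 8" .
qed

text \<open>
  A Lebesgue constant estimate; the sharp order in \<open>N\<close> is \<open>ln N\<close>, but any subpolynomial growth
  will do.
\<close>
lemma sum_dirichlet_poly_le:
  fixes N M :: nat
  assumes \<epsilon>: "0 < \<epsilon>" "\<epsilon> \<le> 1" and N: "1 \<le> N" "N \<le> M" and \<rho>: "0 \<le> \<rho>" "\<rho> \<le> 1 + 1 / real N"
    and \<zeta>: "norm \<zeta> = 1"
  shows "(\<Sum>m<M. norm (dirichlet_poly N (of_real \<rho> * (\<zeta> * cis (2 * pi * m / M)))))
           \<le> 32 / \<epsilon> * M * real N powr \<epsilon>"
proof -
  define g where "g s = norm (dirichlet_poly N (of_real \<rho> * cis (2 * pi * s / M)))" for s :: real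
  define P where "P s = (\<Sum>m<M. g (s + real m))" for s
  have M: "M > 0" using N by simp
  have per: "g (s + real M) = g s" for s
    using M by (simp add: g_def add_divide_distrib distrib_left flip: cis_mult)
  \<comment> \<open>Moving the grid of M equispaced points by one step permutes it, so only the
    fractional part of the offset matters.\<close>
  interpret P: periodic_fun_simple' P
  proof
    fix s
    have "P (s + 1) + g s = (\<Sum>m<Suc M. g (s + real m))"
      unfolding P_def by (subst sum.lessThan_Suc_shift) (simp add: add_ac)
    also have "\<dots> = P s + g s" using per by (simp add: P_def)
    finally show "P (s + 1) = P s" by simp
  qed
  \<comment> \<open>Up to the factor 8, a bound for the kernel at grid distance q from the point 1.
    Interpolating the bounds N and M/q with exponents \<epsilon> and 1 - \<epsilon> replaces the
    harmonic sum, and with it the logarithm, by a sum of powers; at q = 0 only the bound N is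
    available.\<close>
  define H where "H q = (if q = 0 then real N else real N powr \<epsilon> * (M / real q) powr (1 - \<epsilon>))" for q :: nat
  have H0: "H q \<ge> 0" for q unfolding H_def by simp
  have gH: "g (t + real m) \<le> 8 * (H m + H (M - Suc m))" if t: "0 \<le> t" "t < 1" and m: "m < M" for t m
  proof -
    define s where "s = (t + real m) / M"
    \<comment> \<open>Since 0 \<le> t < 1, the point t + m is at least m away from 0 and at least M
      - m - 1 away from M, so q/M bounds the distance of s to both ends of [0, 1] from
      below.\<close>
    define q where "q = min m (M - Suc m)"
    let ?D = "norm (dirichlet_poly N (of_real \<rho> * cis (2 * pi * s)))"
    have "g (t + real m) \<le> 8 * H q"
    proof (cases "q = 0")
      case True
      then show ?thesis using dirichlet_poly_bounds(1)[of N \<rho>] N \<rho> by (simp add: H_def g_def)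
    next
      case False
      have s: "0 \<le> s" "s \<le> 1" "real q / M \<le> s" "real q / M \<le> 1 - s"
        using t m M False by (auto simp: s_def q_def field_simps of_nat_diff)
      have qM: "real q / M > 0" using False M by simp
      have "?D * (real q / M) \<le> ?D * norm (cis (2 * pi * s) - 1)"
      proof (rule mult_left_mono)
        show "real q / M \<le> norm (cis (2 * pi * s) - 1)"
          using norm_cis_minus_one_ge[OF s(1,2)] s qM by (auto simp: min_def split: if_splits)
      qed simp
      also have "\<dots> \<le> 8" using N \<rho> by (intro dirichlet_poly_bounds) auto
      finally have 2: "?D \<le> 8 * (M / real q)" using False M by (simp add: field_simps)
      have 1: "?D \<le> 8 * N" using N \<rho> by (intro dirichlet_poly_bounds) auto
      have "?D = ?D powr \<epsilon> * ?D powr (1 - \<epsilon>)" by (simp flip: powr_add)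
      also have "\<dots> \<le> (8 * N) powr \<epsilon> * (8 * (M / real q)) powr (1 - \<epsilon>)"
        using 1 2 \<epsilon> by (intro mult_mono powr_mono2) auto
      also have "\<dots> = (8 powr \<epsilon> * 8 powr (1 - \<epsilon>)) * H q"
        using False by (simp add: powr_mult powr_divide H_def)
      also have "8 powr \<epsilon> * 8 powr (1 - \<epsilon>) = (8 :: real)" by (simp flip: powr_add)
      finally show ?thesis by (simp add: g_def s_def)
    qed
    also have "H q \<le> H m + H (M - Suc m)" using H0 by (auto simp: q_def min_def)
    finally show ?thesis by simp
  qed
  have NM: "real N powr \<epsilon> * (M powr (1 - \<epsilon>) * M powr \<epsilon>) = real N powr \<epsilon> * M"
    using M by (simp flip: powr_add)
  have "(\<Sum>m<M. H m) = H 0 + (\<Sum>m=1..M - 1. H m)"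
    using M by (subst lessThan_atLeast0, subst sum.atLeast_Suc_lessThan) (auto intro!: sum.cong)
  also have "(\<Sum>m=1..M - 1. H m) = real N powr \<epsilon> * M powr (1 - \<epsilon>) * (\<Sum>q=1..M - 1. real q powr (\<epsilon> - 1))"
    unfolding sum_distrib_left
  proof (rule sum.cong)
    fix q assume "q \<in> {1..M - 1}"
    then show "H q = real N powr \<epsilon> * M powr (1 - \<epsilon>) * real q powr (\<epsilon> - 1)"
      using powr_minus_divide[of "real q" "1 - \<epsilon>"] by (simp add: H_def powr_divide)
  qed simp
  also have "\<dots> \<le> real N powr \<epsilon> * M powr (1 - \<epsilon>) * (M powr \<epsilon> / \<epsilon>)"
  proof (intro mult_left_mono)
    have "(\<Sum>q=1..M - 1. real q powr (\<epsilon> - 1)) \<le> real (M - 1) powr \<epsilon> / \<epsilon>"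
      by (rule sum_powr_minus_le[OF \<epsilon>])
    also have "\<dots> \<le> M powr \<epsilon> / \<epsilon>" using \<epsilon> by (intro divide_right_mono powr_mono2) auto
    finally show "(\<Sum>q=1..M - 1. real q powr (\<epsilon> - 1)) \<le> M powr \<epsilon> / \<epsilon>" .
  qed auto
  also have "\<dots> = real N powr \<epsilon> * M / \<epsilon>" using NM by (simp add: mult.assoc)
  also have "H 0 \<le> real N powr \<epsilon> * M / \<epsilon>"
  proof -
    have "1 * real N / 1 \<le> real N powr \<epsilon> * M / \<epsilon>"
      using N \<epsilon> by (intro frac_le mult_mono ge_one_powr_ge_zero) auto
    then show ?thesis by (simp add: H_def)
  qed
  finally have sumH: "(\<Sum>m<M. H m) \<le> 2 * (real N powr \<epsilon> * M / \<epsilon>)" by linarith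
  obtain \<tau> where \<tau>: "\<zeta> = cis \<tau>"
    using \<zeta> by (metis cis_Arg complex_norm_eq_1_exp cis_conv_exp)
  \<comment> \<open>The argument of \<zeta>, measured in steps 2 \<pi> / M of the grid.\<close>
  define s where "s = \<tau> * M / (2 * pi)"
  have "(\<Sum>m<M. norm (dirichlet_poly N (of_real \<rho> * (\<zeta> * cis (2 * pi * m / M))))) = P s"
  proof -
    have "\<tau> + 2 * pi * m / M = 2 * pi * (s + real m) / M" for m :: nat
      using M by (simp add: s_def add_divide_distrib distrib_left)
    then show ?thesis by (simp add: P_def g_def \<tau> cis_mult)
  qed
  also have "\<dots> = P (frac s)"
    using P.minus_of_int[of s "\<lfloor>s\<rfloor>"] by (simp add: frac_def)
  \<comment> \<open>Both ends of the grid contribute the same sum after reversal. The final constant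
    is 32 = 8 * 2 * 2: the kernel bound, the two ends, and the two parts of the sum of H (q = 0 and
    q \<ge> 1).\<close>
  also have "\<dots> \<le> (\<Sum>m<M. 8 * (H m + H (M - Suc m)))"
    unfolding P_def by (intro sum_mono gH) (auto simp: frac_lt_1)
  also have "\<dots> = 8 * ((\<Sum>m<M. H m) + (\<Sum>m<M. H (M - Suc m)))"
    by (simp add: sum_distrib_left sum.distrib)
  also have "(\<Sum>m<M. H (M - Suc m)) = (\<Sum>m<M. H m)" by (rule sum.nat_diff_reindex)
  also have "8 * ((\<Sum>m<M. H m) + (\<Sum>m<M. H m)) \<le> 32 * (real N powr \<epsilon> * M / \<epsilon>)"
    using mult_left_mono[OF sumH, of 16] by simp
  also have "\<dots> = 32 / \<epsilon> * M * real N powr \<epsilon>"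
    by (simp only: times_divide_eq_left times_divide_eq_right mult_ac)
  finally show ?thesis .
qed

lemma cnj_dirichlet_poly: "cnj (dirichlet_poly N u) = dirichlet_poly N (cnj u)"
  by (simp add: dirichlet_poly_def)

text \<open>The form needed for blocks, whose indices start at N - 1 and whose inverse transform
  uses conjugate roots of unity. Conjugating the kernel restores the forward grid, and the offset s
  is absorbed as a rotation of \<zeta>.\<close>

lemma sum_dirichlet_poly_shift_le:
  fixes N M s :: nat
  assumes "0 < \<epsilon>" "\<epsilon> \<le> 1" "1 \<le> N" "N \<le> M" "0 \<le> \<rho>" "\<rho> \<le> 1 + 1 / real N" "norm \<zeta> = 1"
  shows "(\<Sum>m=s..<s + M. norm (dirichlet_poly N (of_real \<rho> * (\<zeta> * cis (- (2 * pi * m / M))))))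
           \<le> 32 / \<epsilon> * M * real N powr \<epsilon>"
proof -
  let ?\<zeta> = "cnj \<zeta> * cis (2 * pi * s / M)"
  have M: "M > 0" using assms by simp
  have "norm (dirichlet_poly N (of_real \<rho> * (\<zeta> * cis (- (2 * pi * real (m + s) / M)))))
      = norm (dirichlet_poly N (of_real \<rho> * (?\<zeta> * cis (2 * pi * m / M))))" for m
  proof -
    have "norm (dirichlet_poly N (of_real \<rho> * (\<zeta> * cis (- (2 * pi * real (m + s) / M)))))
        = norm (cnj (dirichlet_poly N (of_real \<rho> * (\<zeta> * cis (- (2 * pi * real (m + s) / M))))))"
      by (rule complex_mod_cnj[symmetric])
    also have "cnj (dirichlet_poly N (of_real \<rho> * (\<zeta> * cis (- (2 * pi * real (m + s) / M)))))
      = dirichlet_poly N (of_real \<rho> * (cnj \<zeta> * cis (2 * pi * real (m + s) / M)))"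
      by (simp add: cnj_dirichlet_poly cis_cnj)
    also have "cis (2 * pi * real (m + s) / M) = cis (2 * pi * s / M) * cis (2 * pi * m / M)"
      by (simp add: cis_mult add_divide_distrib[symmetric] algebra_simps)
    finally show ?thesis by (simp only: mult.assoc)
  qed
  then have "(\<Sum>m=s..<s + M. norm (dirichlet_poly N (of_real \<rho> * (\<zeta> * cis (- (2 * pi * m / M))))))
      = (\<Sum>m<M. norm (dirichlet_poly N (of_real \<rho> * (?\<zeta> * cis (2 * pi * m / M)))))"
    using sum.shift_bounds_nat_ivl[of "\<lambda>m. norm (dirichlet_poly N (of_real \<rho> * (\<zeta> * cis (- (2 * pi * real m / M)))))" 0 s M]
    by (simp add: lessThan_atLeast0 add.commute)
  also have "\<dots> \<le> 32 / \<epsilon> * M * real N powr \<epsilon>"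
    by (rule sum_dirichlet_poly_le) (use assms in \<open>auto simp: norm_mult\<close>)
  finally show ?thesis .
qed

lemma sum_power_dirichlet_poly:
  assumes "1 \<le> N"
  shows "(\<Sum>i=N - 1..<2 * N - 1. u ^ i) = u ^ (N - 1) * dirichlet_poly N u"
proof -
  have "{N - 1..<2 * N - 1} = {0 + (N - 1)..<N + (N - 1)}" using assms by auto
  then have "(\<Sum>i=N - 1..<2 * N - 1. u ^ i) = (\<Sum>i=0..<N. u ^ (i + (N - 1)))"
    by (simp only: sum.shift_bounds_nat_ivl)
  also have "\<dots> = u ^ (N - 1) * dirichlet_poly N u"
    unfolding dirichlet_poly_def lessThan_atLeast0 sum_distrib_left
    by (simp only: power_add mult.commute)
  finally show ?thesis .
qed

text \<open>A geometric sum with ratio q satisfying q^N = 1; |i - j| < N with i \<noteq> j excludes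
  q = 1. Starting at s only multiplies the sum by q^s.\<close>

lemma sum_cis_orthogonal:
  fixes i j N s :: nat
  assumes "i < j + N" "j < i + N"
  shows "(\<Sum>m=s..<s + N. cis (2 * pi * ((real i - real j) * real m) / real N))
           = (if i = j then of_nat N else 0)"
proof (cases "i = j")
  case False
  have N: "N > 0" using assms by simp
  \<comment> \<open>The chord estimate shows that 1 is not attained strictly between two multiples
    of N.\<close>
  have ne: "cis (2 * pi * (real k / N)) \<noteq> 1" if "0 < k" "k < N" for k :: nat
  proof
    assume "cis (2 * pi * (real k / N)) = 1"
    then have "2 * min (real k / N) (1 - real k / N) \<le> 0"
      using norm_cis_minus_one_ge[of "real k / N"] that by simp
    then show False using that by (auto simp: min_def field_simps split: if_splits)
  qed
  define q where "q = cis (2 * pi * ((real i - real j) / N))"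
  have "q \<noteq> 1"
  proof (cases "j < i")
    case True
    then show ?thesis using ne[of "i - j"] assms by (simp add: q_def of_nat_diff)
  next
    case False
    then have "cis (2 * pi * (real (j - i) / N)) = inverse q"
      by (simp add: q_def of_nat_diff minus_divide_left flip: mult_minus_right)
    then show ?thesis using ne[of "j - i"] assms False \<open>i \<noteq> j\<close> by auto
  qed
  have qN: "q ^ N = 1"
  proof -
    have "q ^ N = cis (2 * pi * of_int (int i - int j))"
      using N by (simp add: q_def Complex.DeMoivre)
    then show ?thesis by (simp only: cis_multiple_2pi Ints_of_int)
  qed
  have "(\<Sum>m=s..<s + N. cis (2 * pi * ((real i - real j) * real m) / real N)) = (\<Sum>m=s..<s + N. q ^ m)"
    by (intro sum.cong refl) (simp add: q_def Complex.DeMoivre mult_ac)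
  also have "\<dots> = q ^ s * (\<Sum>m<N. q ^ m)"
    using sum.shift_bounds_nat_ivl[of "\<lambda>m. q ^ m" 0 s N]
    by (simp add: lessThan_atLeast0 sum_distrib_left power_add mult.commute add.commute)
  also have "(\<Sum>m<N. q ^ m) = 0" using \<open>q \<noteq> 1\<close> qN by (simp add: sum_gp_strict)
  finally show ?thesis using False by simp
qed simp

section \<open>Dyadic blocks and the Fourier transform on each of them\<close>

definition block_scale :: "nat \<Rightarrow> nat" where
  "block_scale j = 2 ^ floor_log (Suc j)"

text \<open>The dyadic block that contains j. Because \<open>block_scale\<close> is computed from j
  + 1, the index 0 forms a block of size 1 and the blocks tile all natural numbers.\<close>

definition block :: "nat \<Rightarrow> nat set" where
  "block j = {block_scale j - 1..<2 * block_scale j - 1}"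

text \<open>The output index j runs through the same block as i: its N consecutive integers
  represent every residue modulo N once, so sequences are mapped to sequences without
  reindexing.\<close>

definition block_dft :: "(nat \<Rightarrow> complex) \<Rightarrow> nat \<Rightarrow> complex" where
  "block_dft a j = (\<Sum>i\<in>block j. a i * cis (2 * pi * (real i * real j) / block_scale j))"

definition block_idft :: "(nat \<Rightarrow> complex) \<Rightarrow> nat \<Rightarrow> complex" where
  "block_idft x i =
     (\<Sum>j\<in>block i. x j * cis (- (2 * pi * (real i * real j) / block_scale i))) / block_scale i"

lemma block_scale_pos: "1 \<le> block_scale j"
  by (simp add: block_scale_def)

lemma block_scale_le: "block_scale j \<le> Suc j"
  by (simp add: block_scale_def floor_log_exp2_le)

lemma block_scale_gt: "Suc j < 2 * block_scale j"
  by (simp add: block_scale_def floor_log_exp2_gt)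

lemma in_block_self: "j \<in> block j"
  using block_scale_le[of j] block_scale_gt[of j] by (auto simp: block_def)

lemma finite_block: "finite (block j)"
  by (simp add: block_def)

lemma block_scale_eq:
  assumes "i \<in> block j" shows "block_scale i = block_scale j"
proof -
  have "2 ^ floor_log (Suc j) \<le> Suc i" "Suc i < 2 * 2 ^ floor_log (Suc j)"
    using assms by (auto simp: block_def block_scale_def)
  then have "floor_log (Suc i) = floor_log (Suc j)" by (intro floor_log_eqI) auto
  then show ?thesis by (simp add: block_scale_def)
qed

lemma block_eq:
  assumes "i \<in> block j" shows "block i = block j"
  unfolding block_def block_scale_eq[OF assms] by (rule refl)

lemma block_shift: "block j = {block_scale j - 1..<block_scale j - 1 + block_scale j}"
  using block_scale_pos[of j] by (auto simp: block_def)

text \<open>Two indices of one block differ by less than N, so after exchanging the sums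
  orthogonality of the characters leaves only the diagonal term, with weight N.\<close>

lemma block_idft_dft: "block_idft (block_dft a) i = a i"
proof -
  let ?N = "block_scale i" and ?B = "block i"
  have "(\<Sum>j\<in>?B. block_dft a j * cis (- (2 * pi * (real i * real j) / ?N)))
      = (\<Sum>j\<in>?B. \<Sum>k\<in>?B. a k * cis (2 * pi * ((real k - real i) * real j) / ?N))"
  proof (intro sum.cong refl)
    fix j assume j: "j \<in> ?B"
    show "block_dft a j * cis (- (2 * pi * (real i * real j) / ?N))
        = (\<Sum>k\<in>?B. a k * cis (2 * pi * ((real k - real i) * real j) / ?N))"
      unfolding block_dft_def block_eq[OF j] block_scale_eq[OF j] sum_distrib_right
    proof (intro sum.cong refl)
      fix k
      have "2 * pi * (real k * real j) / ?N + - (2 * pi * (real i * real j) / ?N)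
          = 2 * pi * ((real k - real i) * real j) / ?N"
        by (simp only: left_diff_distrib right_diff_distrib diff_divide_distrib add_uminus_conv_diff)
      then show "a k * cis (2 * pi * (real k * real j) / ?N) * cis (- (2 * pi * (real i * real j) / ?N))
          = a k * cis (2 * pi * ((real k - real i) * real j) / ?N)"
        by (simp only: mult.assoc cis_mult)
    qed
  qed
  also have "\<dots> = (\<Sum>k\<in>?B. a k * (\<Sum>j\<in>?B. cis (2 * pi * ((real k - real i) * real j) / ?N)))"
    by (subst sum.swap) (simp add: sum_distrib_left)
  also have "\<dots> = (\<Sum>k\<in>?B. a k * (if k = i then of_nat ?N else 0))"
  proof (intro sum.cong refl arg_cong2[where f = "(*)"])
    fix k assume "k \<in> ?B"
    then have "k < i + ?N" "i < k + ?N"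
      using in_block_self[of i] unfolding block_shift atLeastLessThan_iff by linarith+
    then show "(\<Sum>j\<in>?B. cis (2 * pi * ((real k - real i) * real j) / ?N))
        = (if k = i then of_nat ?N else 0)"
      unfolding block_shift by (rule sum_cis_orthogonal)
  qed
  also have "\<dots> = (\<Sum>k\<in>?B. if k = i then a i * of_nat ?N else 0)"
    by (intro sum.cong refl) auto
  also have "\<dots> = a i * of_nat ?N"
    using in_block_self[of i] by (simp add: finite_block)
  finally show ?thesis
    using block_scale_pos[of i] by (simp add: block_idft_def)
qed

lemma block_dft_idft: "block_dft (block_idft x) j = x j"
proof -
  let ?N = "block_scale j" and ?B = "block j"
  have "block_dft (block_idft x) j
      = (\<Sum>i\<in>?B. \<Sum>k\<in>?B. x k / ?N * cis (2 * pi * ((real j - real k) * real i) / ?N))"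
    unfolding block_dft_def
  proof (intro sum.cong refl)
    fix i assume i: "i \<in> ?B"
    show "block_idft x i * cis (2 * pi * (real i * real j) / ?N)
        = (\<Sum>k\<in>?B. x k / ?N * cis (2 * pi * ((real j - real k) * real i) / ?N))"
      unfolding block_idft_def block_eq[OF i] block_scale_eq[OF i] sum_distrib_right sum_divide_distrib
    proof (intro sum.cong refl)
      fix k
      have "- (2 * pi * (real i * real k) / ?N) + 2 * pi * (real i * real j) / ?N
          = 2 * pi * ((real j - real k) * real i) / ?N"
        by (simp only: left_diff_distrib right_diff_distrib diff_divide_distrib uminus_add_conv_diff mult.commute)
      then show "x k * cis (- (2 * pi * (real i * real k) / ?N)) / ?N * cis (2 * pi * (real i * real j) / ?N)
          = x k / ?N * cis (2 * pi * ((real j - real k) * real i) / ?N)"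
        by (simp only: times_divide_eq_left mult.assoc cis_mult)
    qed
  qed
  also have "\<dots> = (\<Sum>k\<in>?B. x k / ?N * (\<Sum>i\<in>?B. cis (2 * pi * ((real j - real k) * real i) / ?N)))"
    by (subst sum.swap) (simp add: sum_distrib_left)
  also have "\<dots> = (\<Sum>k\<in>?B. x k / ?N * (if j = k then of_nat ?N else 0))"
  proof (intro sum.cong refl arg_cong2[where f = "(*)"])
    fix k assume "k \<in> ?B"
    then have "k < j + ?N" "j < k + ?N"
      using in_block_self[of j] unfolding block_shift atLeastLessThan_iff by linarith+
    then show "(\<Sum>i\<in>?B. cis (2 * pi * ((real j - real k) * real i) / ?N))
        = (if j = k then of_nat ?N else 0)"
      unfolding block_shift by (intro sum_cis_orthogonal)
  qed
  also have "\<dots> = (\<Sum>k\<in>?B. if j = k then x k else 0)"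
  proof (intro sum.cong refl)
    show "x k / ?N * (if j = k then of_nat ?N else 0) = (if j = k then x k else 0)" for k
      using block_scale_pos[of j] by (cases "j = k") auto
  qed
  also have "\<dots> = x j"
    using in_block_self[of j] by (simp add: finite_block)
  finally show ?thesis .
qed

text \<open>
  The block is recovered from the values on the circle of radius \<open>N / (N + 1)\<close> by a Cauchy formula
  discretised at the \<open>M\<close>-th roots of unity; on polynomials of degree less than \<open>M\<close> it is exact.
\<close>
lemma norm_poly_block_le:
  fixes a :: "nat \<Rightarrow> complex"
  assumes \<epsilon>: "0 < \<epsilon>" "\<epsilon> \<le> 1" and N: "1 \<le> N" "2 * N \<le> M" and \<zeta>: "norm \<zeta> = 1"
    and B: "\<And>w. norm w = real N / (real N + 1) \<Longrightarrow> norm (\<Sum>i<M. a i * w ^ i) \<le> B"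
  shows "norm (\<Sum>i=N - 1..<2 * N - 1. a i * \<zeta> ^ i) \<le> 96 / \<epsilon> * real N powr \<epsilon> * B"
proof -
  \<comment> \<open>The polynomial is sampled at radius r and the kernel evaluated at the reciprocal
    radius \<rho>, so r^i \<rho>^j becomes 1 on the diagonal i = j.\<close>
  define r where "r = real N / (real N + 1)"
  define \<rho> where "\<rho> = 1 + 1 / real N"
  have r: "r > 0" and r\<rho>: "r * \<rho> = 1" and \<rho>: "\<rho> > 0"
    using N by (auto simp: r_def \<rho>_def divide_simps add_pos_pos)
  define w where "w m = of_real r * cis (2 * pi * m / M)" for m :: nat
  define u where "u m = of_real \<rho> * (\<zeta> * cis (- (2 * pi * m / M)))" for m :: nat
  let ?K = "{N - 1..<2 * N - 1}"
  have nu: "norm (u m) = \<rho>" for m using \<rho> \<zeta> by (simp add: u_def norm_mult)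
  have M: "M > 0" using N by simp
  have B0: "0 \<le> B" using B[of "of_real r"] r norm_ge_zero by (metis abs_of_pos norm_of_real order_trans r_def)
  have \<rho>N: "\<rho> ^ (N - 1) \<le> 3"
  proof -
    have "\<rho> ^ (N - 1) \<le> \<rho> ^ N" by (intro power_increasing) (auto simp: \<rho>_def)
    also have "\<dots> \<le> exp (1 / real N) ^ N"
      unfolding \<rho>_def by (intro power_mono exp_ge_add_one_self) auto
    also have "\<dots> = exp 1" using N by (simp flip: exp_of_nat_mult)
    finally show ?thesis using exp_le by linarith
  qed
  \<comment> \<open>The product of the samples with the kernel \<Sum> u^j over the block is the
    discretised Cauchy integrand; summing over the grid isolates M times the part of the polynomial
    in the block, evaluated at \<zeta>.\<close>
  have "(\<Sum>m<M. (\<Sum>i<M. a i * w m ^ i) * (\<Sum>j\<in>?K. u m ^ j))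
      = (\<Sum>m<M. \<Sum>i<M. \<Sum>j\<in>?K. a i * of_real (r ^ i * \<rho> ^ j) * \<zeta> ^ j *
           cis (2 * pi * ((real i - real j) * real m) / M))"
    unfolding sum_product
  proof (intro sum.cong refl)
    fix m i j :: nat
    have "w m ^ i * u m ^ j = of_real (r ^ i * \<rho> ^ j) * \<zeta> ^ j *
        (cis (2 * pi * m / M) ^ i * cis (- (2 * pi * m / M)) ^ j)"
      by (simp add: w_def u_def power_mult_distrib)
    also have "cis (2 * pi * m / M) ^ i * cis (- (2 * pi * m / M)) ^ j
        = cis (2 * pi * ((real i - real j) * real m) / M)"
      unfolding Complex.DeMoivre cis_mult by (simp add: algebra_simps diff_divide_distrib)
    finally show "a i * w m ^ i * u m ^ j = a i * of_real (r ^ i * \<rho> ^ j) * \<zeta> ^ j *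
        cis (2 * pi * ((real i - real j) * real m) / M)"
      by (simp add: mult.assoc)
  qed
  also have "\<dots> = (\<Sum>i<M. \<Sum>m<M. \<Sum>j\<in>?K. a i * of_real (r ^ i * \<rho> ^ j) * \<zeta> ^ j *
           cis (2 * pi * ((real i - real j) * real m) / M))"
    by (rule sum.swap)
  also have "\<dots> = (\<Sum>i<M. \<Sum>j\<in>?K. \<Sum>m<M. a i * of_real (r ^ i * \<rho> ^ j) * \<zeta> ^ j *
           cis (2 * pi * ((real i - real j) * real m) / M))"
    by (intro sum.cong refl sum.swap)
  also have "\<dots> = (\<Sum>j\<in>?K. \<Sum>i<M. \<Sum>m<M. a i * of_real (r ^ i * \<rho> ^ j) * \<zeta> ^ j *
           cis (2 * pi * ((real i - real j) * real m) / M))"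
    by (rule sum.swap)
  also have "\<dots> = (\<Sum>j\<in>?K. \<Sum>i<M. a i * of_real (r ^ i * \<rho> ^ j) * \<zeta> ^ j *
           (\<Sum>m<M. cis (2 * pi * ((real i - real j) * real m) / M)))"
    by (simp only: sum_distrib_left)
  \<comment> \<open>There is no aliasing: i < M by assumption, and j < 2 N - 1 < M on the
    block.\<close>
  also have "\<dots> = (\<Sum>j\<in>?K. \<Sum>i<M. a i * of_real (r ^ i * \<rho> ^ j) * \<zeta> ^ j * (if i = j then of_nat M else 0))"
  proof (intro sum.cong refl arg_cong2[where f = "(*)"])
    fix i j assume "j \<in> ?K" "i \<in> {..<M}"
    then have "i < j + M" "j < i + M" using N by auto
    from sum_cis_orthogonal[OF this, of 0]
    show "(\<Sum>m<M. cis (2 * pi * ((real i - real j) * real m) / M)) = (if i = j then of_nat M else 0)"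
      by (simp add: lessThan_atLeast0)
  qed
  also have "\<dots> = (\<Sum>j\<in>?K. a j * \<zeta> ^ j * of_nat M)"
  proof (intro sum.cong refl)
    fix j assume "j \<in> ?K"
    then have "j < M" using N by auto
    then have "(\<Sum>i<M. a i * of_real (r ^ i * \<rho> ^ j) * \<zeta> ^ j * (if i = j then of_nat M else 0))
        = a j * of_real ((r * \<rho>) ^ j) * \<zeta> ^ j * of_nat M"
      by (simp add: if_distrib power_mult_distrib cong: if_cong)
    then show "(\<Sum>i<M. a i * of_real (r ^ i * \<rho> ^ j) * \<zeta> ^ j * (if i = j then of_nat M else 0))
        = a j * \<zeta> ^ j * of_nat M" by (simp add: r\<rho>)
  qed
  finally have eq: "(\<Sum>m<M. (\<Sum>i<M. a i * w m ^ i) * (\<Sum>j\<in>?K. u m ^ j))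
      = of_nat M * (\<Sum>j\<in>?K. a j * \<zeta> ^ j)"
    by (simp add: sum_distrib_left mult.commute)
  have "real M * norm (\<Sum>j\<in>?K. a j * \<zeta> ^ j)
      = norm (\<Sum>m<M. (\<Sum>i<M. a i * w m ^ i) * (\<Sum>j\<in>?K. u m ^ j))"
    unfolding eq by (simp add: norm_mult)
  also have "\<dots> \<le> (\<Sum>m<M. B * (3 * norm (dirichlet_poly N (u m))))"
  proof (rule sum_norm_le)
    fix m
    have "norm (\<Sum>j\<in>?K. u m ^ j) = \<rho> ^ (N - 1) * norm (dirichlet_poly N (u m))"
      unfolding sum_power_dirichlet_poly[OF N(1)] by (simp add: norm_mult norm_power nu)
    also have "\<dots> \<le> 3 * norm (dirichlet_poly N (u m))"
      by (intro mult_right_mono \<rho>N) auto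
    finally have "norm (\<Sum>j\<in>?K. u m ^ j) \<le> 3 * norm (dirichlet_poly N (u m))" .
    moreover have "norm (\<Sum>i<M. a i * w m ^ i) \<le> B"
      using r by (intro B) (simp add: w_def norm_mult flip: r_def)
    ultimately show "norm ((\<Sum>i<M. a i * w m ^ i) * (\<Sum>j\<in>?K. u m ^ j))
        \<le> B * (3 * norm (dirichlet_poly N (u m)))"
      unfolding norm_mult using B0 by (intro mult_mono) auto
  qed
  also have "\<dots> = 3 * B * (\<Sum>m=0..<0 + M. norm (dirichlet_poly N (u m)))"
    by (simp add: sum_distrib_left lessThan_atLeast0 mult_ac)
  \<comment> \<open>96 = 3 * 32, with 3 bounding \<rho>^(N-1) and 32 coming from the kernel
    sum.\<close>
  also have "\<dots> \<le> 3 * B * (32 / \<epsilon> * M * real N powr \<epsilon>)"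
    unfolding u_def using B0 \<epsilon> N \<zeta> \<rho>
    by (intro mult_left_mono sum_dirichlet_poly_shift_le) (auto simp: \<rho>_def)
  also have "\<dots> = real M * (96 / \<epsilon> * real N powr \<epsilon> * B)" by simp
  finally show ?thesis by (rule mult_left_le_imp_le) (use M in simp)
qed

text \<open>The polynomial estimate is applied to the Taylor polynomials of f. Its constant does not
  depend on the truncation M, and the absolutely convergent tail at radius N/(N+1) tends to 0, so
  letting M grow gives the bound for f itself.\<close>

lemma norm_block_dft_le:
  fixes a :: "nat \<Rightarrow> complex"
  assumes \<epsilon>: "0 < \<epsilon>" "\<epsilon> \<le> 1"
    and sums: "\<And>w. norm w < 1 \<Longrightarrow> (\<lambda>i. a i * w ^ i) sums f w"
    and B: "\<And>w. norm w = real (block_scale j) / (real (block_scale j) + 1) \<Longrightarrow> norm (f w) \<le> B"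
  shows "norm (block_dft a j) \<le> 96 / \<epsilon> * real (block_scale j) powr \<epsilon> * B"
proof -
  let ?N = "block_scale j" and ?r = "real (block_scale j) / (real (block_scale j) + 1)"
  define \<zeta> where "\<zeta> = cis (2 * pi * j / ?N)"
  have r: "0 \<le> ?r" "?r < 1" by auto
  have dft: "block_dft a j = (\<Sum>i=?N - 1..<2 * ?N - 1. a i * \<zeta> ^ i)"
    unfolding block_dft_def block_def \<zeta>_def Complex.DeMoivre by (simp add: mult_ac)
  \<comment> \<open>Convergence at the larger radius (r + 1)/2 < 1 makes the series absolutely
    convergent at r.\<close>
  have "summable (\<lambda>i. norm (a i * of_real ?r ^ i))"
  proof (rule powser_insidea)
    show "summable (\<lambda>i. a i * of_real ((?r + 1) / 2) ^ i)"
      by (rule sums_summable[OF sums]) (simp only: norm_of_real, use r in auto)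
    show "norm (of_real ?r :: complex) < norm (of_real ((?r + 1) / 2) :: complex)"
      unfolding norm_of_real using r by (subst (1 2) abs_of_nonneg) (auto simp: field_simps)
  qed
  then have su: "summable (\<lambda>i. norm (a i) * ?r ^ i)"
    unfolding norm_mult norm_power norm_of_real using r by simp
  have "\<forall>\<^sub>F M in sequentially. norm (block_dft a j) \<le> 96 / \<epsilon> * real ?N powr \<epsilon> *
     (B + (\<Sum>i. norm (a (i + M)) * ?r ^ (i + M)))"
    using eventually_ge_at_top[of "2 * ?N"]
  proof eventually_elim
    case (elim M)
    show ?case unfolding dft
    proof (rule norm_poly_block_le[OF \<epsilon> block_scale_pos elim])
      show "norm \<zeta> = 1" by (simp add: \<zeta>_def)
      fix w :: complex assume w: "norm w = ?r"
      then have w1: "norm w < 1" using r by simp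
      have su': "summable (\<lambda>i. norm (a (i + M) * w ^ (i + M)))"
        using su w by (subst summable_iff_shift) (simp add: norm_mult norm_power)
      have "(\<Sum>i<M. a i * w ^ i) = f w - (\<Sum>i. a (i + M) * w ^ (i + M))"
        using sums_unique[OF sums[OF w1]] suminf_minus_initial_segment[OF sums_summable[OF sums[OF w1]], of M]
        by simp
      also have "norm \<dots> \<le> norm (f w) + norm (\<Sum>i. a (i + M) * w ^ (i + M))"
        by (rule norm_triangle_ineq4)
      also have "\<dots> \<le> B + (\<Sum>i. norm (a (i + M) * w ^ (i + M)))"
        by (intro add_mono B w summable_norm su')
      finally show "norm (\<Sum>i<M. a i * w ^ i) \<le> B + (\<Sum>i. norm (a (i + M)) * ?r ^ (i + M))"
        using w by (simp add: norm_mult norm_power)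
    qed
  qed
  moreover have "(\<lambda>M. 96 / \<epsilon> * real ?N powr \<epsilon> * (B + (\<Sum>i. norm (a (i + M)) * ?r ^ (i + M))))
      \<longlonglongrightarrow> 96 / \<epsilon> * real ?N powr \<epsilon> * (B + 0)"
    by (intro tendsto_intros suminf_exist_split2 su)
  ultimately show ?thesis
    by (intro tendsto_lowerbound[of _ _ sequentially]) auto
qed

text \<open>Interpolation from the samples: the block polynomial is the average of x_j u_j^(N-1)
  D_N(u_j) with u_j = z times the conjugate of the j-th root of unity. The factor |z|^(N-1) is kept,
  since it later supplies all the decay in N.\<close>

lemma norm_block_idft_poly_le:
  assumes \<epsilon>: "0 < \<epsilon>" "\<epsilon> \<le> 1" and z: "norm z \<le> 1"
    and X: "\<And>j. j \<in> block k \<Longrightarrow> norm (x j) \<le> X"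
  shows "norm (\<Sum>i\<in>block k. block_idft x i * z ^ i)
           \<le> 32 / \<epsilon> * real (block_scale k) powr \<epsilon> * X * norm z ^ (block_scale k - 1)"
proof -
  let ?N = "block_scale k" and ?B = "block k"
  have N: "?N \<ge> 1" by (rule block_scale_pos)
  define u where "u j = z * cis (- (2 * pi * j / ?N))" for j :: nat
  obtain \<zeta> where \<zeta>: "norm \<zeta> = 1" "z = of_real (norm z) * \<zeta>"
    by (metis Arg_eq cis_conv_exp norm_cis mult_zero_left norm_zero of_real_0)
  have "(\<Sum>i\<in>?B. block_idft x i * z ^ i)
      = (\<Sum>i\<in>?B. \<Sum>j\<in>?B. x j / ?N * u j ^ i)"
  proof (intro sum.cong refl)
    fix i assume i: "i \<in> ?B"
    show "block_idft x i * z ^ i = (\<Sum>j\<in>?B. x j / ?N * u j ^ i)"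
      unfolding block_idft_def block_eq[OF i] block_scale_eq[OF i] sum_distrib_right sum_divide_distrib
      by (intro sum.cong refl) (simp add: u_def power_mult_distrib Complex.DeMoivre mult_ac)
  qed
  also have "\<dots> = (\<Sum>j\<in>?B. x j / ?N * (\<Sum>i\<in>?B. u j ^ i))"
    by (subst sum.swap) (simp add: sum_distrib_left)
  finally have eq: "(\<Sum>i\<in>?B. block_idft x i * z ^ i) = (\<Sum>j\<in>?B. x j / ?N * (\<Sum>i\<in>?B. u j ^ i))" .
  have X0: "0 \<le> X" using X[OF in_block_self] norm_ge_zero order_trans by blast
  have "norm (\<Sum>i\<in>?B. block_idft x i * z ^ i)
      \<le> (\<Sum>j\<in>?B. X / ?N * (norm z ^ (?N - 1) * norm (dirichlet_poly ?N (u j))))"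
    unfolding eq
  proof (rule sum_norm_le)
    fix j assume j: "j \<in> ?B"
    have "norm (x j / ?N * (\<Sum>i\<in>?B. u j ^ i)) = norm (x j) / ?N * (norm z ^ (?N - 1) * norm (dirichlet_poly ?N (u j)))"
      unfolding block_def sum_power_dirichlet_poly[OF N]
      by (simp add: norm_mult norm_divide norm_power u_def)
    also have "\<dots> \<le> X / ?N * (norm z ^ (?N - 1) * norm (dirichlet_poly ?N (u j)))"
      by (intro mult_right_mono divide_right_mono X j) auto
    finally show "norm (x j / ?N * (\<Sum>i\<in>?B. u j ^ i))
      \<le> X / ?N * (norm z ^ (?N - 1) * norm (dirichlet_poly ?N (u j)))" .
  qed
  also have "\<dots> = X / ?N * norm z ^ (?N - 1) * (\<Sum>j\<in>?B. norm (dirichlet_poly ?N (u j)))"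
    unfolding sum_distrib_left by (simp only: mult.assoc)
  also have "\<dots> \<le> X / ?N * norm z ^ (?N - 1) * (32 / \<epsilon> * ?N * real ?N powr \<epsilon>)"
  proof (rule mult_left_mono)
    have "u j = of_real (norm z) * (\<zeta> * cis (- (2 * pi * j / ?N)))" for j
      by (simp only: u_def mult.assoc[symmetric] \<zeta>(2)[symmetric])
    then show "(\<Sum>j\<in>?B. norm (dirichlet_poly ?N (u j))) \<le> 32 / \<epsilon> * ?N * real ?N powr \<epsilon>"
      unfolding block_shift using sum_dirichlet_poly_shift_le[OF \<epsilon> N order_refl _ _ \<zeta>(1), of "norm z"] z
      by (simp add: add_increasing2)
  qed (use X0 in auto)
  also have "\<dots> = 32 / \<epsilon> * real ?N powr \<epsilon> * X * norm z ^ (?N - 1)" using N by simp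
  finally show ?thesis .
qed

section \<open>Weights and norms\<close>

text \<open>With y = N (1 - r) one has r^(N-1) \<le> 3 exp (-y) and y powr \<nu> \<le> \<nu> powr
  \<nu> * exp y. The product is bounded by 3 \<nu> powr \<nu>, uniformly in r and N.\<close>

lemma power_decay:
  assumes "0 < \<nu>"
  obtains C where "C > 0"
    "\<And>N r. 1 \<le> N \<Longrightarrow> 0 \<le> r \<Longrightarrow> r < 1 \<Longrightarrow> (1 - r) powr \<nu> * r ^ (N - 1) \<le> C * real N powr - \<nu>"
proof
  show "3 * \<nu> powr \<nu> > 0" using assms by simp
  fix N :: nat and r :: real assume N: "1 \<le> N" and r: "0 \<le> r" "r < 1"
  define y where "y = real N * (1 - r)"
  have y: "0 \<le> y" using r by (simp add: y_def)
  have "r ^ (N - 1) \<le> exp (- (1 - r)) ^ (N - 1)"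
    using r exp_ge_add_one_self[of "- (1 - r)"] by (intro power_mono) auto
  also have "\<dots> = exp (real (N - 1) * (- (1 - r)))" by (simp only: exp_of_nat_mult)
  also have "\<dots> = exp (1 - r) * exp (- y)"
    using N by (simp add: y_def of_nat_diff algebra_simps flip: exp_add)
  also have "\<dots> \<le> 3 * exp (- y)"
  proof (rule mult_right_mono)
    have "exp (1 - r) \<le> exp 1" using r by simp
    then show "exp (1 - r) \<le> 3" using exp_le by linarith
  qed simp
  finally have 1: "r ^ (N - 1) \<le> 3 * exp (- y)" .
  have "(y / \<nu>) powr \<nu> \<le> exp (y / \<nu>) powr \<nu>"
  proof (rule powr_mono2)
    show "y / \<nu> \<le> exp (y / \<nu>)" using exp_ge_add_one_self[of "y / \<nu>"] by linarith
  qed (use y assms in auto)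
  also have "\<dots> = exp y" using assms by (simp add: powr_def)
  finally have 2: "y powr \<nu> \<le> \<nu> powr \<nu> * exp y"
    using y assms by (simp add: powr_divide divide_simps mult.commute)
  have "y powr \<nu> * r ^ (N - 1) \<le> (\<nu> powr \<nu> * exp y) * (3 * exp (- y))"
    using r by (intro mult_mono 1 2) auto
  also have "\<dots> = 3 * \<nu> powr \<nu>" by (simp add: exp_minus)
  finally have "(y powr \<nu> * r ^ (N - 1)) * real N powr - \<nu> \<le> 3 * \<nu> powr \<nu> * real N powr - \<nu>"
    by (rule mult_right_mono) simp
  moreover have "(y powr \<nu> * r ^ (N - 1)) * real N powr - \<nu> = (1 - r) powr \<nu> * r ^ (N - 1)"
    using N r by (simp add: y_def powr_mult powr_minus)
  ultimately show "(1 - r) powr \<nu> * r ^ (N - 1) \<le> 3 * \<nu> powr \<nu> * real N powr - \<nu>"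
    by (simp only:)
qed

lemma s_weight_altdef: "0 < \<mu> \<Longrightarrow> s_weight \<mu> j = (\<mu> / (real j + \<mu>)) powr \<mu>"
  by (simp add: s_weight_def)

text \<open>The quotient \<mu> (j + 1) / (j + \<mu>) lies between min 1 \<mu> and max 1 \<mu>.
  Together with \<open>s_weight_ge\<close> this makes the weight comparable to (j + 1) powr
  -\<mu>.\<close>

lemma s_weight_le:
  assumes "0 < \<mu>"
  shows "s_weight \<mu> j * real (Suc j) powr \<mu> \<le> max 1 \<mu> powr \<mu>"
proof -
  have "s_weight \<mu> j * real (Suc j) powr \<mu> = (\<mu> * real (Suc j) / (real j + \<mu>)) powr \<mu>"
    using assms by (simp add: s_weight_altdef powr_mult powr_divide)
  also have "\<dots> \<le> max 1 \<mu> powr \<mu>"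
  proof (rule powr_mono2)
    have "\<mu> * real (Suc j) \<le> max 1 \<mu> * (real j + \<mu>)"
    proof (cases "\<mu> \<le> 1")
      case True
      then have "\<mu> * real j \<le> 1 * real j" by (intro mult_right_mono) auto
      then show ?thesis using True by (simp add: distrib_left)
    next
      case False
      then have "\<mu> * 1 \<le> \<mu> * \<mu>" by (intro mult_left_mono) auto
      then show ?thesis using False by (simp add: distrib_left)
    qed
    then show "\<mu> * real (Suc j) / (real j + \<mu>) \<le> max 1 \<mu>"
      using assms by (simp add: pos_divide_le_eq)
  qed (use assms in auto)
  finally show ?thesis .
qed

lemma s_weight_ge:
  assumes "0 < \<mu>"
  shows "min 1 \<mu> powr \<mu> \<le> s_weight \<mu> j * real (Suc j) powr \<mu>"
proof -
  have "min 1 \<mu> powr \<mu> \<le> (\<mu> * real (Suc j) / (real j + \<mu>)) powr \<mu>"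
  proof (rule powr_mono2)
    have "min 1 \<mu> * (real j + \<mu>) \<le> \<mu> * real (Suc j)"
    proof (cases "\<mu> \<le> 1")
      case True
      then have "\<mu> * \<mu> \<le> \<mu> * 1" using assms by (intro mult_left_mono) auto
      then show ?thesis using True by (simp add: distrib_left)
    next
      case False
      then have "1 * real j \<le> \<mu> * real j" by (intro mult_right_mono) auto
      then show ?thesis using False by (simp add: distrib_left)
    qed
    then show "min 1 \<mu> \<le> \<mu> * real (Suc j) / (real j + \<mu>)"
      using assms by (simp add: pos_le_divide_eq)
  qed (use assms in auto)
  also have "\<dots> = s_weight \<mu> j * real (Suc j) powr \<mu>"
    using assms by (simp add: s_weight_altdef powr_mult powr_divide)
  finally show ?thesis .
qed

lemma growth_norm_ge:
  assumes f: "f \<in> A_minus \<mu>" and z: "norm z < 1"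
  shows "norm (f z) * (1 - norm z) powr \<mu> \<le> growth_norm \<mu> f"
proof -
  have an: "f analytic_on ball 0 1" and bdd: "bdd_above ((\<lambda>r. M_infty f r * (1 - r) powr \<mu>) ` {0..<1})"
    using f unfolding A_minus_def by auto
  have "norm (f z) \<le> M_infty f (norm z)"
    using M_infty_le_iff[OF an, of "norm z" "M_infty f (norm z)"] z by simp
  then have "norm (f z) * (1 - norm z) powr \<mu> \<le> M_infty f (norm z) * (1 - norm z) powr \<mu>"
    by (intro mult_right_mono) auto
  also have "\<dots> \<le> growth_norm \<mu> f"
    unfolding growth_norm_def by (rule cSUP_upper[OF _ bdd]) (use z in simp)
  finally show ?thesis .
qed

lemma growth_norm_le:
  assumes f: "f analytic_on ball 0 1"
    and C: "\<And>z. norm z < 1 \<Longrightarrow> norm (f z) * (1 - norm z) powr \<mu> \<le> C"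
  shows "growth_norm \<mu> f \<le> C"
  unfolding growth_norm_def
proof (rule cSUP_least)
  fix r :: real assume r: "r \<in> {0..<1}"
  have "M_infty f r \<le> C / (1 - r) powr \<mu>"
    using C r by (subst M_infty_le_iff[OF f]) (auto simp: pos_le_divide_eq)
  then show "M_infty f r * (1 - r) powr \<mu> \<le> C"
    using r by (simp add: pos_le_divide_eq)
qed simp

lemma growth_norm_nonneg: "f \<in> A_minus \<mu> \<Longrightarrow> 0 \<le> growth_norm \<mu> f"
  using growth_norm_ge[of f \<mu> 0] by (simp add: order_trans[OF norm_ge_zero])

lemma growth_norm_triangle:
  assumes f: "f \<in> A_minus \<mu>" and g: "g \<in> A_minus \<mu>"
  shows "growth_norm \<mu> (\<lambda>z. f z + g z) \<le> growth_norm \<mu> f + growth_norm \<mu> g"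
proof (rule growth_norm_le)
  show "(\<lambda>z. f z + g z) analytic_on ball 0 1"
    using f g by (intro analytic_on_add) (auto simp: A_minus_def)
  fix z :: complex assume z: "norm z < 1"
  have "norm (f z + g z) * (1 - norm z) powr \<mu>
      \<le> (norm (f z) + norm (g z)) * (1 - norm z) powr \<mu>"
    by (intro mult_right_mono norm_triangle_ineq) auto
  then show "norm (f z + g z) * (1 - norm z) powr \<mu> \<le> growth_norm \<mu> f + growth_norm \<mu> g"
    using growth_norm_ge[OF f z] growth_norm_ge[OF g z] by (simp add: distrib_right)
qed

lemma linf_norm_ge: "x \<in> linf w \<Longrightarrow> w j * norm (x j) \<le> linf_norm w x"
  unfolding linf_norm_def linf_def by (auto intro: cSUP_upper)

lemma linf_normI:
  assumes "\<And>j. w j * norm (x j) \<le> C"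
  shows "x \<in> linf w" "linf_norm w x \<le> C"
  using assms unfolding linf_norm_def linf_def
  by (auto intro!: cSUP_least simp: bdd_above_def)

lemma linf_norm_triangle:
  assumes "\<And>j. 0 \<le> w j" "x \<in> linf w" "y \<in> linf w"
  shows "linf_norm w (\<lambda>j. x j + y j) \<le> linf_norm w x + linf_norm w y"
proof (rule linf_normI)
  fix j
  have "w j * norm (x j + y j) \<le> w j * norm (x j) + w j * norm (y j)"
    using mult_left_mono[OF norm_triangle_ineq assms(1)] by (simp add: distrib_left)
  then show "w j * norm (x j + y j) \<le> linf_norm w x + linf_norm w y"
    using linf_norm_ge[OF assms(2), of j] linf_norm_ge[OF assms(3), of j] by linarith
qed

section \<open>The isomorphism\<close>

definition taylor_coeff :: "(complex \<Rightarrow> complex) \<Rightarrow> nat \<Rightarrow> complex" where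
  "taylor_coeff f i = (deriv ^^ i) f 0 / fact i"

definition analysis_map :: "(complex \<Rightarrow> complex) \<Rightarrow> nat \<Rightarrow> complex" where
  "analysis_map f = block_dft (taylor_coeff f)"

text \<open>The value 0 off the disc is the one prescribed by \<open>A_minus\<close>.\<close>

definition synthesis_map :: "(nat \<Rightarrow> complex) \<Rightarrow> complex \<Rightarrow> complex" where
  "synthesis_map x z = (if norm z < 1 then \<Sum>i. block_idft x i * z ^ i else 0)"

lemma taylor_coeff_sums:
  assumes "f analytic_on ball 0 1" "norm z < 1"
  shows "(\<lambda>i. taylor_coeff f i * z ^ i) sums f z"
  using holomorphic_power_series[of f 0 1 z] assms
  by (simp add: taylor_coeff_def analytic_imp_holomorphic)

lemma analysis_map_linear: "fun_linear_on {f. f analytic_on ball 0 1} analysis_map"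
proof -
  have "taylor_coeff (\<lambda>z. f z + g z) i = taylor_coeff f i + taylor_coeff g i"
    if "f analytic_on ball 0 1" "g analytic_on ball 0 1" for f g i
    using that unfolding taylor_coeff_def
    by (subst higher_deriv_add[of _ "ball 0 1"]) (auto simp: analytic_imp_holomorphic add_divide_distrib)
  moreover have "taylor_coeff (\<lambda>z. c * f z) i = c * taylor_coeff f i"
    if "f analytic_on ball 0 1" for c f i
    using that unfolding taylor_coeff_def
    by (subst higher_deriv_cmult[of _ "ball 0 1"]) (auto simp: analytic_imp_holomorphic)
  ultimately show ?thesis
    unfolding fun_linear_on_def
    by (auto simp: analysis_map_def block_dft_def fun_eq_iff distrib_right sum.distrib
        sum_distrib_left mult.assoc)
qed

lemma synthesis_analysis:
  assumes "f \<in> A_minus \<mu>" shows "synthesis_map (analysis_map f) = f"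
proof
  fix z
  show "synthesis_map (analysis_map f) z = f z"
    using assms sums_unique[OF taylor_coeff_sums[of f z]]
    by (auto simp: synthesis_map_def analysis_map_def block_idft_dft A_minus_def)
qed

text \<open>At radius N/(N+1) the function is at most its norm times (N + 1) powr \<mu>; the block
  transform adds N powr \<epsilon>, and the weight of order (j + 1) powr -\<nu> absorbs both because
  N \<le> j + 1.\<close>

lemma analysis_map_bound:
  assumes "0 < \<mu>" "\<mu> < \<nu>"
  obtains C where "C > 0"
    "\<And>f. f \<in> A_minus \<mu> \<Longrightarrow> analysis_map f \<in> linf (s_weight \<nu>)"
    "\<And>f. f \<in> A_minus \<mu> \<Longrightarrow> linf_norm (s_weight \<nu>) (analysis_map f) \<le> C * growth_norm \<mu> f"
proof -
  \<comment> \<open>The available gap between the exponents, capped at 1 as the kernel estimate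
    demands.\<close>
  define \<epsilon> where "\<epsilon> = min 1 (\<nu> - \<mu>)"
  have \<epsilon>: "0 < \<epsilon>" "\<epsilon> \<le> 1" "\<epsilon> + \<mu> \<le> \<nu>" using assms by (auto simp: \<epsilon>_def min_def)
  \<comment> \<open>The factors come from the weight, from the kernel estimate, and from N + 1 \<le>
    2 N.\<close>
  define C where "C = max 1 \<nu> powr \<nu> * (96 / \<epsilon> * 2 powr \<mu>)"
  have C: "C > 0" using \<epsilon> by (simp add: C_def)
  have main: "s_weight \<nu> j * norm (analysis_map f j) \<le> C * growth_norm \<mu> f"
    if f: "f \<in> A_minus \<mu>" for f j
  proof -
    let ?N = "real (block_scale j)" and ?G = "growth_norm \<mu> f"
    have G: "0 \<le> ?G" by (rule growth_norm_nonneg[OF f])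
    have N: "?N \<ge> 1" using block_scale_pos[of j] by simp
    have an: "f analytic_on ball 0 1" using f by (simp add: A_minus_def)
    have "norm (f w) \<le> ?G * (2 powr \<mu> * ?N powr \<mu>)" if w: "norm w = ?N / (?N + 1)" for w
    proof -
      have "1 - norm w = 1 / (?N + 1)" using N by (simp add: w divide_simps)
      then have "norm (f w) * (1 / (?N + 1)) powr \<mu> \<le> ?G"
        using growth_norm_ge[OF f, of w] N by (simp add: w)
      then have "norm (f w) \<le> ?G * (?N + 1) powr \<mu>"
        using N by (simp add: powr_divide pos_divide_le_eq)
      also have "\<dots> \<le> ?G * (2 * ?N) powr \<mu>"
        using N assms G by (intro mult_left_mono powr_mono2) auto
      finally show ?thesis using N by (simp add: powr_mult)
    qed
    from norm_block_dft_le[OF \<epsilon>(1,2) taylor_coeff_sums[OF an], of j, OF _ this]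
    have "norm (analysis_map f j) \<le> 96 / \<epsilon> * ?N powr \<epsilon> * (?G * (2 powr \<mu> * ?N powr \<mu>))"
      by (simp add: analysis_map_def)
    also have "\<dots> = 96 / \<epsilon> * 2 powr \<mu> * ?G * ?N powr (\<epsilon> + \<mu>)"
      by (simp add: powr_add)
    also have "\<dots> \<le> 96 / \<epsilon> * 2 powr \<mu> * ?G * real (Suc j) powr \<nu>"
    proof (rule mult_left_mono)
      have "?N powr (\<epsilon> + \<mu>) \<le> ?N powr \<nu>" using N \<epsilon> by (intro powr_mono) auto
      also have "\<dots> \<le> real (Suc j) powr \<nu>"
        using block_scale_le[of j] N assms by (intro powr_mono2) auto
      finally show "?N powr (\<epsilon> + \<mu>) \<le> real (Suc j) powr \<nu>" .
    qed (use \<epsilon> G in auto)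
    finally have "s_weight \<nu> j * norm (analysis_map f j)
        \<le> s_weight \<nu> j * (96 / \<epsilon> * 2 powr \<mu> * ?G * real (Suc j) powr \<nu>)"
      using s_weight_pos[of \<nu> j] assms by (intro mult_left_mono) auto
    also have "\<dots> = (96 / \<epsilon> * 2 powr \<mu> * ?G) * (s_weight \<nu> j * real (Suc j) powr \<nu>)"
      by (simp only: mult_ac)
    also have "\<dots> \<le> (96 / \<epsilon> * 2 powr \<mu> * ?G) * max 1 \<nu> powr \<nu>"
      using \<epsilon> G assms by (intro mult_left_mono s_weight_le) auto
    also have "\<dots> = C * ?G" by (simp only: C_def mult_ac)
    finally show ?thesis .
  qed
  show ?thesis
    by (rule that[OF C]) (use linf_normI[OF main] in auto)
qed

lemma linf_s_weight_growth:
  assumes "0 < \<mu>" "x \<in> linf (s_weight \<mu>)"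
  shows "norm (x j) \<le> linf_norm (s_weight \<mu>) x / min 1 \<mu> powr \<mu> * real (Suc j) powr \<mu>"
proof -
  have p: "min 1 \<mu> powr \<mu> > 0" using assms by (auto simp: min_def)
  have "min 1 \<mu> powr \<mu> * norm (x j) \<le> (s_weight \<mu> j * real (Suc j) powr \<mu>) * norm (x j)"
    by (intro mult_right_mono s_weight_ge assms) auto
  also have "\<dots> = (s_weight \<mu> j * norm (x j)) * real (Suc j) powr \<mu>" by (simp only: mult_ac)
  also have "\<dots> \<le> linf_norm (s_weight \<mu>) x * real (Suc j) powr \<mu>"
    by (intro mult_right_mono linf_norm_ge assms) auto
  finally show ?thesis using p by (simp add: pos_le_divide_eq mult.commute)
qed

lemma linf_norm_s_weight_nonneg:
  assumes "0 < \<mu>" "x \<in> linf (s_weight \<mu>)"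
  shows "0 \<le> linf_norm (s_weight \<mu>) x"
  by (rule order_trans[OF _ linf_norm_ge[OF assms(2), of 0]])
    (use s_weight_pos[OF assms(1), of 0] in auto)

lemma norm_le_on_block:
  assumes "0 < \<mu>" "x \<in> linf (s_weight \<mu>)" "j \<in> block k"
  shows "norm (x j) \<le> linf_norm (s_weight \<mu>) x / min 1 \<mu> powr \<mu> * (2 powr \<mu> * real (block_scale k) powr \<mu>)"
proof -
  have "norm (x j) \<le> linf_norm (s_weight \<mu>) x / min 1 \<mu> powr \<mu> * real (Suc j) powr \<mu>"
    by (rule linf_s_weight_growth[OF assms(1,2)])
  also have "\<dots> \<le> linf_norm (s_weight \<mu>) x / min 1 \<mu> powr \<mu> * (2 * real (block_scale k)) powr \<mu>"
  proof (intro mult_left_mono powr_mono2)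
    show "real (Suc j) \<le> 2 * real (block_scale k)"
      using assms(3) unfolding block_def by auto
  qed (use assms linf_norm_s_weight_nonneg in auto)
  finally show ?thesis by (simp add: powr_mult)
qed

text \<open>The crude bound without any kernel estimate; it is enough for convergence of the
  synthesised power series.\<close>

lemma norm_block_idft_le:
  assumes X: "\<And>j. j \<in> block i \<Longrightarrow> norm (x j) \<le> X"
  shows "norm (block_idft x i) \<le> X"
proof -
  let ?N = "block_scale i"
  have N: "?N \<ge> 1" by (rule block_scale_pos)
  have "norm (\<Sum>j\<in>block i. x j * cis (- (2 * pi * (real i * real j) / ?N))) \<le> (\<Sum>j\<in>block i. X)"
    by (rule sum_norm_le) (use X in \<open>simp add: norm_mult\<close>)
  also have "\<dots> = ?N * X" by (simp add: block_shift)
  finally show ?thesis using N by (simp add: block_idft_def norm_divide pos_divide_le_eq mult.commute)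
qed

lemma summable_block_idft:
  assumes \<mu>: "0 < \<mu>" and x: "x \<in> linf (s_weight \<mu>)" and z: "norm z < 1"
  shows "summable (\<lambda>i. block_idft x i * z ^ i)"
proof -
  \<comment> \<open>The coefficients grow at most like (i + 1) powr \<mu>; the exponent \<mu> + 2
    leaves a summable (i + 1) powr -2.\<close>
  obtain C where C: "C > 0" "\<And>N r. 1 \<le> N \<Longrightarrow> 0 \<le> r \<Longrightarrow> r < 1 \<Longrightarrow>
      (1 - r) powr (\<mu> + 2) * r ^ (N - 1) \<le> C * real N powr - (\<mu> + 2)"
    using power_decay[of "\<mu> + 2"] \<mu> by (metis add_pos_pos zero_less_numeral)
  define K where "K = linf_norm (s_weight \<mu>) x / min 1 \<mu> powr \<mu> * 2 powr \<mu>"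
  have K: "K \<ge> 0" using linf_norm_s_weight_nonneg[OF \<mu> x] by (simp add: K_def)
  let ?d = "(1 - norm z) powr (\<mu> + 2)"
  have d: "?d > 0" using z by simp
  have "norm (block_idft x i * z ^ i) \<le> K * C / ?d * real (Suc i) powr - 2" for i
  proof -
    let ?s = "real (Suc i)"
    have "norm (block_idft x i) \<le> K * real (block_scale i) powr \<mu>"
      using norm_block_idft_le[OF norm_le_on_block[OF \<mu> x]] by (simp add: K_def mult.assoc)
    also have "\<dots> \<le> K * ?s powr \<mu>"
      using K block_scale_le[of i] \<mu> by (intro mult_left_mono powr_mono2) auto
    finally have 1: "norm (block_idft x i) \<le> K * ?s powr \<mu>" .
    have "norm z ^ i \<le> C * ?s powr - (\<mu> + 2) / ?d"
      using C(2)[of "Suc i" "norm z"] z d by (simp add: pos_le_divide_eq mult.commute)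
    then have "norm (block_idft x i * z ^ i) \<le> (K * ?s powr \<mu>) * (C * ?s powr - (\<mu> + 2) / ?d)"
      unfolding norm_mult norm_power using 1 K by (intro mult_mono) auto
    also have "\<dots> = K * C / ?d * (?s powr \<mu> * ?s powr - (\<mu> + 2))"
      by (simp only: times_divide_eq_left times_divide_eq_right mult_ac)
    also have "?s powr \<mu> * ?s powr - (\<mu> + 2) = ?s powr - 2" by (simp flip: powr_add)
    finally show ?thesis .
  qed
  moreover have "summable (\<lambda>i. K * C / ?d * real (Suc i) powr - 2)"
  proof (rule summable_mult)
    have "summable (\<lambda>i. real i powr - 2)" by (simp add: summable_real_powr_iff)
    then show "summable (\<lambda>i. real (Suc i) powr - 2)" by (subst summable_Suc_iff)
  qed
  ultimately show ?thesis
    by (blast intro: summable_comparison_test'[where N = 0 and g = "\<lambda>i. K * C / ?d * real (Suc i) powr - 2"])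
qed

text \<open>Besides analyticity this yields, by uniqueness of power series, that the Taylor
  coefficients of \<open>synthesis_map x\<close> are \<open>block_idft x\<close>.\<close>

lemma synthesis_map_has_fps_expansion:
  assumes \<mu>: "0 < \<mu>" and x: "x \<in> linf (s_weight \<mu>)"
  shows "synthesis_map x analytic_on ball 0 1"
    and "synthesis_map x has_fps_expansion Abs_fps (block_idft x)"
proof -
  let ?F = "Abs_fps (block_idft x)"
  have R: "fps_conv_radius ?F \<ge> 1"
    unfolding fps_conv_radius_def
  proof (rule conv_radius_geI_ex)
    fix r :: real assume "0 < r" "ereal r < 1"
    then show "\<exists>z. norm z = r \<and> summable (\<lambda>n. fps_nth ?F n * z ^ n)"
      using summable_block_idft[OF \<mu> x, of "of_real r"] by (intro exI[of _ "of_real r"]) auto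
  qed
  have eq: "synthesis_map x z = eval_fps ?F z" if "z \<in> ball 0 1" for z
    using that by (simp add: synthesis_map_def eval_fps_def)
  have "ball 0 1 \<subseteq> eball (0 :: complex) (fps_conv_radius ?F)"
    using R by (auto simp: in_eball_iff) (metis ereal_less_eq(3) less_ereal.simps(1) one_ereal_def order_less_le_trans)
  then have "eval_fps ?F holomorphic_on ball 0 1" by (rule holomorphic_on_eval_fps)
  then show "synthesis_map x analytic_on ball 0 1"
    using eq holomorphic_transform[of _ "ball 0 1" "synthesis_map x"]
    by (simp add: analytic_on_open)
  have "\<forall>\<^sub>F z in nhds 0. z \<in> ball (0 :: complex) 1" by (intro eventually_nhds_in_open) auto
  then have "\<forall>\<^sub>F z in nhds 0. eval_fps ?F z = synthesis_map x z"
    by eventually_elim (simp add: eq)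
  then show "synthesis_map x has_fps_expansion ?F"
    unfolding has_fps_expansion_def using less_le_trans[OF _ R, of 0] by simp
qed

lemma analysis_synthesis:
  assumes "0 < \<mu>" "x \<in> linf (s_weight \<mu>)"
  shows "analysis_map (synthesis_map x) = x"
proof -
  have "taylor_coeff (synthesis_map x) = block_idft x"
    using fps_nth_fps_expansion[OF synthesis_map_has_fps_expansion(2)[OF assms]]
    by (auto simp: taylor_coeff_def)
  then show ?thesis by (auto simp: analysis_map_def block_dft_idft)
qed

text \<open>2^k - 1 is the first index of the block of size 2^k and serves as a name for it;
  consecutive blocks abut.\<close>

lemma sum_blocks:
  "(\<Sum>k<n. \<Sum>i\<in>block (2 ^ k - 1). g i) = (\<Sum>i<2 ^ n - 1. g i :: complex)"
proof (induction n)
  case (Suc n)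
  have "block_scale (2 ^ n - 1) = 2 ^ n" by (simp add: block_scale_def)
  then have "(\<Sum>i\<in>block (2 ^ n - 1). g i) = (\<Sum>i=2 ^ n - 1..<2 ^ Suc n - 1. g i)"
    by (simp add: block_def)
  then show ?case
    using Suc.IH sum.atLeastLessThan_concat[of 0 "2 ^ n - 1" "2 ^ Suc n - 1" g]
    by (simp add: lessThan_atLeast0 diff_le_mono)
qed simp

text \<open>On the block of size N = 2^k the kernel costs N powr \<epsilon>, the sequence grows like
  N powr \<mu>, and the weighted factor |z|^(N-1) gains N powr -\<nu>. The blocks are thus dominated
  by a geometric series with ratio q < 1, uniformly in z.\<close>

lemma synthesis_map_bound:
  assumes "0 < \<mu>" "\<mu> < \<nu>"
  obtains C where "C > 0"
    "\<And>x. x \<in> linf (s_weight \<mu>) \<Longrightarrow> synthesis_map x \<in> A_minus \<nu>"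
    "\<And>x. x \<in> linf (s_weight \<mu>) \<Longrightarrow> growth_norm \<nu> (synthesis_map x) \<le> C * linf_norm (s_weight \<mu>) x"
proof -
  \<comment> \<open>Half the gap is taken so that \<epsilon> + \<mu> < \<nu> strictly, which is what
    makes q < 1.\<close>
  define \<epsilon> where "\<epsilon> = min 1 ((\<nu> - \<mu>) / 2)"
  have \<epsilon>: "0 < \<epsilon>" "\<epsilon> \<le> 1" "\<epsilon> + \<mu> < \<nu>" using assms by (auto simp: \<epsilon>_def min_def field_simps)
  define q where "q = 2 powr (\<epsilon> + \<mu> - \<nu>)"
  have q: "0 < q" "q < 1"
    using \<epsilon> powr_less_cancel_iff[of 2 "\<epsilon> + \<mu> - \<nu>" 0] by (auto simp: q_def)
  have "0 < \<nu>" using assms by simp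
  then obtain D where D: "D > 0" "\<And>N r. 1 \<le> N \<Longrightarrow> 0 \<le> r \<Longrightarrow> r < 1 \<Longrightarrow>
      (1 - r) powr \<nu> * r ^ (N - 1) \<le> D * real N powr - \<nu>"
    using power_decay by metis
  define c where "c = 32 / \<epsilon> * (2 powr \<mu> / min 1 \<mu> powr \<mu>) * D"
  have c: "c > 0" using \<epsilon> D assms by (auto simp: c_def min_def)
  have main: "norm (synthesis_map x z) * (1 - norm z) powr \<nu> \<le> c / (1 - q) * linf_norm (s_weight \<mu>) x"
    if x: "x \<in> linf (s_weight \<mu>)" and z: "norm z < 1" for x z
  proof -
    let ?L = "linf_norm (s_weight \<mu>) x" and ?w = "(1 - norm z) powr \<nu>"
    have L: "0 \<le> ?L" using linf_norm_s_weight_nonneg assms x by blast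
    let ?X = "\<lambda>N. ?L / min 1 \<mu> powr \<mu> * (2 powr \<mu> * N powr \<mu>)"
    let ?s = "\<lambda>n. \<Sum>i<2 ^ n - 1. block_idft x i * z ^ i"
    have blk: "norm (\<Sum>i\<in>block (2 ^ k - 1). block_idft x i * z ^ i) * ?w \<le> c * ?L * q ^ k" for k
    proof -
      have bs: "block_scale (2 ^ k - 1) = 2 ^ k" by (simp add: block_scale_def)
      let ?N = "2 ^ k :: real"
      have N: "?N = 2 powr k" by (simp add: powr_realpow)
      have "norm (\<Sum>i\<in>block (2 ^ k - 1). block_idft x i * z ^ i)
          \<le> 32 / \<epsilon> * ?N powr \<epsilon> * ?X ?N * norm z ^ (2 ^ k - 1)"
      proof -
        have *: "norm (x j) \<le> ?X ?N" if "j \<in> block (2 ^ k - 1)" for j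
          using norm_le_on_block[OF assms(1) x that] unfolding bs of_nat_power of_nat_numeral .
        show ?thesis
          using norm_block_idft_poly_le[OF \<epsilon>(1,2) less_imp_le[OF z], of "2 ^ k - 1" x "?X ?N"] *
          unfolding bs of_nat_power of_nat_numeral by blast
      qed
      then have "norm (\<Sum>i\<in>block (2 ^ k - 1). block_idft x i * z ^ i) * ?w
          \<le> 32 / \<epsilon> * ?N powr \<epsilon> * ?X ?N * norm z ^ (2 ^ k - 1) * ?w"
        by (intro mult_right_mono) auto
      also have "\<dots> = 32 / \<epsilon> * ?N powr \<epsilon> * ?X ?N * (?w * norm z ^ (2 ^ k - 1))"
        by (simp only: mult_ac)
      also have "\<dots> \<le> 32 / \<epsilon> * ?N powr \<epsilon> * ?X ?N * (D * ?N powr - \<nu>)"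
        using D(2)[of "2 ^ k" "norm z"] z L \<epsilon> by (intro mult_left_mono) auto
      also have "\<dots> = c * ?L * (?N powr \<epsilon> * ?N powr \<mu> * ?N powr - \<nu>)"
        by (simp only: c_def times_divide_eq_left times_divide_eq_right mult_ac)
      also have "?N powr \<epsilon> * ?N powr \<mu> * ?N powr - \<nu> = ?N powr (\<epsilon> + \<mu> - \<nu>)"
        by (simp flip: powr_add)
      also have "\<dots> = q ^ k"
      proof -
        have "q ^ k = q powr k" using q by (simp add: powr_realpow)
        then show ?thesis by (simp only: N q_def powr_powr mult.commute)
      qed
      finally show ?thesis .
    qed
    have "norm (?s n) * ?w \<le> c / (1 - q) * ?L" for n
    proof -
      have "norm (?s n) * ?w \<le> (\<Sum>k<n. norm (\<Sum>i\<in>block (2 ^ k - 1). block_idft x i * z ^ i)) * ?w"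
        unfolding sum_blocks[symmetric] by (intro mult_right_mono norm_sum) auto
      also have "\<dots> \<le> (\<Sum>k<n. c * ?L * q ^ k)"
        unfolding sum_distrib_right by (intro sum_mono blk)
      also have "\<dots> = c * ?L * (\<Sum>k<n. q ^ k)" by (simp add: sum_distrib_left)
      also have "\<dots> \<le> c * ?L * (1 / (1 - q))"
      proof (rule mult_left_mono)
        show "(\<Sum>k<n. q ^ k) \<le> 1 / (1 - q)"
          using sum_le_suminf[of "\<lambda>k. q ^ k" "{..<n}"] q by (simp add: suminf_geometric)
      qed (use c L in auto)
      finally show ?thesis by simp
    qed
    \<comment> \<open>The estimate controls partial sums only at the ends of blocks; this
      subsequence has the same limit as the full series.\<close>
    moreover have "?s \<longlonglongrightarrow> synthesis_map x z"
    proof -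
      have "(\<lambda>i. block_idft x i * z ^ i) sums synthesis_map x z"
        using summable_block_idft[OF assms(1) x z] z by (simp add: synthesis_map_def summable_sums)
      then have "(\<lambda>m. \<Sum>i<m. block_idft x i * z ^ i) \<longlonglongrightarrow> synthesis_map x z"
        by (simp add: sums_def)
      moreover have "filterlim (\<lambda>n. 2 ^ n - 1 :: nat) at_top sequentially"
      proof (rule filterlim_at_top_mono[OF filterlim_ident])
        show "\<forall>\<^sub>F n in sequentially. n \<le> 2 ^ n - 1"
          by (intro always_eventually allI) (metis Suc_leI diff_Suc_1 diff_le_mono less_exp)
      qed
      ultimately show ?thesis by (rule filterlim_compose)
    qed
    ultimately show ?thesis
      by (intro tendsto_upperbound[of "\<lambda>n. norm (?s n) * ?w" _ sequentially]) 
        (auto intro!: tendsto_intros always_eventually)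
  qed
  show ?thesis
  proof (rule that)
    show "c / (1 - q) > 0" using c q by simp
    fix x assume x: "x \<in> linf (s_weight \<mu>)"
    note an = synthesis_map_has_fps_expansion(1)[OF assms(1) x]
    show "synthesis_map x \<in> A_minus \<nu>"
      unfolding A_minus_iff
    proof (intro conjI allI impI exI ballI)
      show "synthesis_map x z = 0" if "z \<notin> ball 0 1" for z
        using that by (simp add: synthesis_map_def)
      show "norm (synthesis_map x z) * (1 - norm z) powr \<nu> \<le> c / (1 - q) * linf_norm (s_weight \<mu>) x"
        if "z \<in> ball 0 1" for z
        using main[OF x] that by simp
    qed (rule an)
    show "growth_norm \<nu> (synthesis_map x) \<le> c / (1 - q) * linf_norm (s_weight \<mu>) x"
      by (rule growth_norm_le[OF an main[OF x]])
  qed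
qed

section \<open>Passage to the projective and inductive limits\<close>

lemma fun_subspace_INT:
  assumes "\<And>i. i \<in> I \<Longrightarrow> fun_subspace (E i)"
  shows "fun_subspace (\<Inter>i\<in>I. E i)"
  using assms unfolding fun_subspace_def by blast

lemma A_minus_subset_analytic: "A_minus \<mu> \<subseteq> {f. f analytic_on ball 0 1}"
  by (auto simp: A_minus_def)

text \<open>The exponents interlace: every \<gamma> + 1/k has some \<mu> strictly between it and
  \<gamma>, and every \<mu> > \<gamma> exceeds some \<gamma> + 1/k. So each target seminorm is
  controlled by a source seminorm with strictly smaller exponent, in both directions.\<close>

lemma A_plus_isomorphic:
  assumes "0 \<le> \<gamma>"
  shows "tvs_isomorphic (A_plus_topology \<gamma>)
           (kothe_echelon_topology {1..} (\<lambda>k. s_weight (\<gamma> + 1 / real k)))"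
proof -
  let ?w = "\<lambda>k. s_weight (\<gamma> + 1 / real k)"
  let ?E = "A_plus \<gamma>" and ?F = "kothe_echelon {1..} ?w"
  have w: "0 < \<gamma> + 1 / real k" if "k \<in> {1..}" for k
    using that assms by (intro add_nonneg_pos) auto
  have w0: "0 \<le> ?w k j" if "k \<in> {1..}" for k j
    using s_weight_pos[OF w[OF that]] by (rule less_imp_le)
  have E: "fun_subspace ?E" unfolding A_plus_def by (intro fun_subspace_INT fun_subspace_A_minus)
  have F: "fun_subspace ?F"
    unfolding kothe_echelon_def by (intro fun_subspace_INT fun_subspace_linf w0)
  have Esub: "?E \<subseteq> A_minus \<mu>" if "\<gamma> < \<mu>" for \<mu> using that unfolding A_plus_def by blast
  have Fsub: "?F \<subseteq> linf (?w k)" if "k \<in> {1..}" for k using that unfolding kothe_echelon_def by blast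
  have fwd: "\<exists>\<mu>\<in>{\<gamma><..}. \<exists>C>0. \<forall>f\<in>?E. analysis_map f \<in> linf (?w k) \<and>
      linf_norm (?w k) (analysis_map f) \<le> C * growth_norm \<mu> f" if k: "k \<in> {1..}" for k
  proof -
    define \<mu> where "\<mu> = \<gamma> + 1 / (2 * real k)"
    have \<mu>: "\<gamma> < \<mu>" "\<mu> < \<gamma> + 1 / real k"
      using k by (auto simp: \<mu>_def divide_simps)
    then have "0 < \<mu>" using assms by simp
    from analysis_map_bound[OF this \<mu>(2)] obtain C where C: "C > 0"
      "\<And>f. f \<in> A_minus \<mu> \<Longrightarrow> analysis_map f \<in> linf (?w k)"
      "\<And>f. f \<in> A_minus \<mu> \<Longrightarrow> linf_norm (?w k) (analysis_map f) \<le> C * growth_norm \<mu> f"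
      by blast
    show ?thesis
      using C Esub[OF \<mu>(1)] \<mu>(1) by (intro bexI[of _ \<mu>] exI[of _ C]) auto
  qed
  have bwd: "\<exists>k\<in>{1..}. \<exists>C>0. \<forall>x\<in>?F. synthesis_map x \<in> A_minus \<mu> \<and>
      growth_norm \<mu> (synthesis_map x) \<le> C * linf_norm (?w k) x" if \<mu>: "\<mu> \<in> {\<gamma><..}" for \<mu>
  proof -
    obtain n where "inverse (real (Suc n)) < \<mu> - \<gamma>" using reals_Archimedean[of "\<mu> - \<gamma>"] \<mu> by auto
    then have k: "Suc n \<in> {1..}" "\<gamma> + 1 / real (Suc n) < \<mu>" by (auto simp: inverse_eq_divide)
    from synthesis_map_bound[OF w[OF k(1)] k(2)] obtain C where C: "C > 0"
      "\<And>x. x \<in> linf (?w (Suc n)) \<Longrightarrow> synthesis_map x \<in> A_minus \<mu>"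
      "\<And>x. x \<in> linf (?w (Suc n)) \<Longrightarrow> growth_norm \<mu> (synthesis_map x) \<le> C * linf_norm (?w (Suc n)) x"
      by blast
    show ?thesis
      using C Fsub[OF k(1)] k(1) by (intro bexI[of _ "Suc n"] exI[of _ C]) auto
  qed
  have T: "analysis_map \<in> ?E \<rightarrow> ?F" using fwd unfolding kothe_echelon_def by fast
  have S: "synthesis_map \<in> ?F \<rightarrow> ?E" using bwd unfolding A_plus_def by fast
  have Tlin: "fun_linear_on ?E analysis_map"
    using fun_linear_on_subset[OF analysis_map_linear] Esub[of "\<gamma> + 1"] A_minus_subset_analytic
    by (meson less_add_one order_trans)
  have ST: "synthesis_map (analysis_map f) = f" if "f \<in> ?E" for f
    using synthesis_analysis Esub[of "\<gamma> + 1"] that by (meson less_add_one subsetD)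
  have TS: "analysis_map (synthesis_map x) = x" if "x \<in> ?F" for x
    using analysis_synthesis[OF w[of 1]] Fsub[of 1] that by auto
  have Slin: "fun_linear_on ?F synthesis_map"
    using fun_linear_on_inverse[OF Tlin E S TS ST] .
  show ?thesis
  proof (rule tvs_isomorphicI[where T = analysis_map and S = synthesis_map])
    show "continuous_map (A_plus_topology \<gamma>) (kothe_echelon_topology {1..} ?w) analysis_map"
      unfolding A_plus_topology_def kothe_echelon_topology_def
    proof (rule continuous_map_seminorm_topology[OF E F Tlin T])
      show "linf_norm (?w k) (\<lambda>j. x j + y j) \<le> linf_norm (?w k) x + linf_norm (?w k) y"
        if "k \<in> {1..}" "x \<in> ?F" "y \<in> ?F" for k x y
        using that w0 Fsub by (intro linf_norm_triangle) auto
      show "\<exists>\<mu>\<in>{\<gamma><..}. \<exists>C>0. \<forall>f\<in>?E. linf_norm (?w k) (analysis_map f) \<le> C * growth_norm \<mu> f"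
        if "k \<in> {1..}" for k using fwd[OF that] by fast
    qed (auto simp: growth_norm_zero linf_norm_zero)
    show "continuous_map (kothe_echelon_topology {1..} ?w) (A_plus_topology \<gamma>) synthesis_map"
      unfolding A_plus_topology_def kothe_echelon_topology_def
    proof (rule continuous_map_seminorm_topology[OF F E Slin S])
      show "growth_norm \<mu> (\<lambda>j. f j + g j) \<le> growth_norm \<mu> f + growth_norm \<mu> g"
        if "\<mu> \<in> {\<gamma><..}" "f \<in> ?E" "g \<in> ?E" for \<mu> f g
        using that Esub by (intro growth_norm_triangle) auto
      show "\<exists>k\<in>{1..}. \<exists>C>0. \<forall>x\<in>?F. growth_norm \<mu> (synthesis_map x) \<le> C * linf_norm (?w k) x"
        if "\<mu> \<in> {\<gamma><..}" for \<mu> using bwd[OF that] by fast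
    qed (auto simp: growth_norm_zero linf_norm_zero)
  qed (use Tlin ST TS in \<open>simp_all add: topspace_A_plus topspace_kothe_echelon\<close>)
qed

lemma continuous_analysis_map_step:
  assumes "0 < \<mu>" "\<mu> < \<nu>"
  shows "continuous_map (A_minus_topology \<mu>) (linf_topology (s_weight \<nu>)) analysis_map"
proof -
  obtain C where C: "C > 0"
    "\<And>f. f \<in> A_minus \<mu> \<Longrightarrow> analysis_map f \<in> linf (s_weight \<nu>)"
    "\<And>f. f \<in> A_minus \<mu> \<Longrightarrow> linf_norm (s_weight \<nu>) (analysis_map f) \<le> C * growth_norm \<mu> f"
    using analysis_map_bound[OF assms] by blast
  have w: "0 \<le> s_weight \<nu> j" for j using s_weight_pos[of \<nu> j] assms by simp
  show ?thesis
    unfolding A_minus_topology_def linf_topology_def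
    using C w
    by (intro continuous_map_seminorm_topology fun_subspace_A_minus fun_subspace_linf
        fun_linear_on_subset[OF analysis_map_linear A_minus_subset_analytic])
      (auto simp: growth_norm_zero linf_norm_zero intro: linf_norm_triangle)
qed

lemma continuous_synthesis_map_step:
  assumes "0 < \<mu>" "\<mu> < \<nu>"
  shows "continuous_map (linf_topology (s_weight \<mu>)) (A_minus_topology \<nu>) synthesis_map"
proof -
  obtain C where C: "C > 0"
    "\<And>x. x \<in> linf (s_weight \<mu>) \<Longrightarrow> synthesis_map x \<in> A_minus \<nu>"
    "\<And>x. x \<in> linf (s_weight \<mu>) \<Longrightarrow> growth_norm \<nu> (synthesis_map x) \<le> C * linf_norm (s_weight \<mu>) x"
    using synthesis_map_bound[OF assms] by blast
  have w: "0 \<le> s_weight \<mu> j" for j using s_weight_pos[of \<mu> j] assms by simp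
  \<comment> \<open>\<open>analysis_map\<close> is not claimed to send \<open>A_minus \<nu>\<close>
    back into \<open>linf (s_weight \<mu>)\<close>; the inverse identities on the two spaces already
    transfer linearity.\<close>
  have "fun_linear_on (linf (s_weight \<mu>)) synthesis_map"
  proof (rule fun_linear_on_inverse)
    show "fun_linear_on (A_minus \<nu>) analysis_map"
      by (rule fun_linear_on_subset[OF analysis_map_linear A_minus_subset_analytic])
  qed (use C(2) fun_subspace_A_minus analysis_synthesis[OF assms(1)] synthesis_analysis in auto)
  then show ?thesis
    unfolding A_minus_topology_def linf_topology_def
    using C w
    by (intro continuous_map_seminorm_topology fun_subspace_A_minus fun_subspace_linf)
      (auto simp: growth_norm_zero linf_norm_zero intro: growth_norm_triangle)
qed

text \<open>Here the exponents interlace from below: each step of one union is mapped continuously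
  into a step of the other with a strictly larger exponent that is still below \<gamma>.\<close>

lemma A_union_isomorphic:
  assumes "0 < \<gamma>"
  shows "tvs_isomorphic (A_union_topology \<gamma>)
           (kothe_coechelon_topology {k. 1 \<le> k \<and> 0 < \<gamma> - 1 / real k}
              (\<lambda>k. s_weight (\<gamma> - 1 / real k)))"
proof -
  let ?K = "{k. 1 \<le> k \<and> 0 < \<gamma> - 1 / real k}" and ?v = "\<lambda>k. s_weight (\<gamma> - 1 / real k)"
  let ?E = "A_union \<gamma>" and ?F = "kothe_coechelon ?K ?v"
  have ex: "\<exists>k\<in>?K. \<mu> < \<gamma> - 1 / real k" if \<mu>: "0 \<le> \<mu>" "\<mu> < \<gamma>" for \<mu>
  proof -
    obtain n where "inverse (real (Suc n)) < \<gamma> - \<mu>" using reals_Archimedean[of "\<gamma> - \<mu>"] \<mu>(2)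
      by (metis diff_gt_0_iff_gt)
    then show ?thesis using \<mu> by (intro bexI[of _ "Suc n"]) (auto simp: inverse_eq_divide)
  qed
  \<comment> \<open>The value \<mu> = 0 in \<open>ex\<close> yields an index with \<gamma> - 1/k >
    0.\<close>
  have K: "?K \<noteq> {}" using ex[of 0] assms by auto
  have decr: "?v l j \<le> ?v k j" if "k \<in> ?K" "l \<in> ?K" "k \<le> l" for k l j
    using that by (intro s_weight_antimono) (auto simp: frac_le)
  have v: "0 < ?v k j" if "k \<in> ?K" for k j using that s_weight_pos by auto
  have topE: "topspace (A_union_topology \<gamma>) = ?E" by (rule topspace_A_union[OF assms])
  have topF: "topspace (kothe_coechelon_topology ?K ?v) = ?F"
    by (rule topspace_kothe_coechelon[OF K v decr])
  have E: "fun_subspace (\<Union>\<mu>\<in>{0<..<\<gamma>}. topspace (A_minus_topology \<mu>))"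
    unfolding topspace_A_minus
    using assms fun_subspace_A_minus
    by (intro fun_subspace_UN) (meson A_minus_mono linear | simp)+
  have F: "fun_subspace (\<Union>k\<in>?K. topspace (linf_topology (?v k)))"
    unfolding topspace_linf
  proof (rule fun_subspace_UN[OF K])
    show "fun_subspace (linf (?v k))" if "k \<in> ?K" for k
      using v[OF that] by (intro fun_subspace_linf less_imp_le)
    show "linf (?v k) \<subseteq> linf (?v l) \<or> linf (?v l) \<subseteq> linf (?v k)" if "k \<in> ?K" "l \<in> ?K" for k l
      using that decr linf_mono[of "?v k" "?v l"] linf_mono[of "?v l" "?v k"] by (meson linear)
  qed
  have Eeq: "(\<Union>\<mu>\<in>{0<..<\<gamma>}. topspace (A_minus_topology \<mu>)) = ?E"
    by (simp add: topspace_A_minus A_union_def)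
  have Feq: "(\<Union>k\<in>?K. topspace (linf_topology (?v k))) = ?F"
    by (simp add: topspace_linf kothe_coechelon_def)
  have Tlin: "fun_linear_on ?E analysis_map"
    by (rule fun_linear_on_subset[OF analysis_map_linear])
      (use A_minus_subset_analytic in \<open>auto simp: A_union_def\<close>)
  have ST: "synthesis_map (analysis_map f) = f" if "f \<in> ?E" for f
    using that synthesis_analysis by (auto simp: A_union_def)
  have TS: "analysis_map (synthesis_map x) = x" if "x \<in> ?F" for x
  proof -
    obtain k where "0 < \<gamma> - 1 / real k" "x \<in> linf (?v k)"
      using \<open>x \<in> ?F\<close> unfolding kothe_coechelon_def by blast
    then show ?thesis by (rule analysis_synthesis)
  qed
  have Sstep: "\<exists>\<mu>\<in>{0<..<\<gamma>}. continuous_map (linf_topology (?v k)) (A_minus_topology \<mu>) synthesis_map"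
    if k: "k \<in> ?K" for k
  proof -
    have k1: "\<gamma> - 1 / real k < \<gamma>" and k2: "0 < \<gamma> - 1 / real k" using k by auto
    obtain \<mu> where \<mu>: "\<gamma> - 1 / real k < \<mu>" "\<mu> < \<gamma>" using dense[OF k1] by blast
    with k2 show ?thesis
      using continuous_synthesis_map_step[OF k2 \<mu>(1)] by (intro bexI[of _ \<mu>]) auto
  qed
  have Tstep: "\<exists>k\<in>?K. continuous_map (A_minus_topology \<mu>) (linf_topology (?v k)) analysis_map"
    if "\<mu> \<in> {0<..<\<gamma>}" for \<mu>
    using ex[of \<mu>] that continuous_analysis_map_step[of \<mu>] by fastforce
  have S: "synthesis_map \<in> ?F \<rightarrow> ?E"
  proof
    fix x assume "x \<in> ?F"
    then obtain k where k: "k \<in> ?K" "x \<in> linf (?v k)" unfolding kothe_coechelon_def by blast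
    from Sstep[OF k(1)] obtain \<mu> where \<mu>: "\<mu> \<in> {0<..<\<gamma>}"
      "continuous_map (linf_topology (?v k)) (A_minus_topology \<mu>) synthesis_map" by blast
    then have "synthesis_map x \<in> A_minus \<mu>"
      using k(2) continuous_map_funspace[OF \<mu>(2)] by (auto simp: topspace_linf topspace_A_minus)
    then show "synthesis_map x \<in> ?E" using \<mu>(1) unfolding A_union_def by blast
  qed
  have Slin: "fun_linear_on ?F synthesis_map"
    using fun_linear_on_inverse[OF Tlin E[unfolded Eeq] S TS ST] .
  show ?thesis
  proof (rule tvs_isomorphicI[where T = analysis_map and S = synthesis_map])
    show "continuous_map (A_union_topology \<gamma>) (kothe_coechelon_topology ?K ?v) analysis_map"
      unfolding A_union_topology_def kothe_coechelon_topology_def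
      by (rule continuous_map_lc_inductive_topology[OF E F]) (use Tlin Tstep in \<open>simp_all only: Eeq\<close>)
    show "continuous_map (kothe_coechelon_topology ?K ?v) (A_union_topology \<gamma>) synthesis_map"
      unfolding A_union_topology_def kothe_coechelon_topology_def
      by (rule continuous_map_lc_inductive_topology[OF F E]) (use Slin Sstep in \<open>simp_all only: Feq\<close>)
  qed (use Tlin ST TS in \<open>simp_all only: topE topF\<close>)
qed

theorem theorem3p2:
  shows "(\<forall>\<gamma>::real. 0 \<le> \<gamma> \<longrightarrow>
            tvs_isomorphic (A_plus_topology \<gamma>)
              (kothe_echelon_topology {1..} (\<lambda>k. s_weight (\<gamma> + 1 / real k)))) \<and>
         (\<forall>\<gamma>::real. 0 < \<gamma> \<longrightarrow>
            tvs_isomorphic (A_union_topology \<gamma>)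
              (kothe_coechelon_topology {k. 1 \<le> k \<and> 0 < \<gamma> - 1 / real k}
                 (\<lambda>k. s_weight (\<gamma> - 1 / real k))))"
  by (intro conjI allI impI A_plus_isomorphic A_union_isomorphic)

end
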